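(* Let $Z_1,\dots,Z_n$ be independent standard quaternion Gaussian random variables and let the $2n$-tuple $(X_{\pm1},X_{\pm2},\dots,X_{\pm n})$ consist of random variables taken, with repetition, from the set $\{Z_1,\dots,Z_n\}$ (without conjugation). Let $j_1,\dots,j_m$ be natural numbers (positive integers) with $j_1+\dots+j_m=n$. Let $\mathcal{M}=\mathcal{M}(X_{\pm1},\dots,X_{\pm n})$ be the set of all bipartite Möbius graphs that correspond to the various ways of pairing all repeated $Z$'s in the sequence $(X_{\pm1},\dots,X_{\pm n})$. Then $$\mathbb{E}\Big(\Re(\overline{X}_{-1}X_1\cdots\overline{X}_{-j_1}X_{j_1})\times\Re(\overline{X}_{-j_1-1}X_{j_1+1}\cdots\overline{X}_{-j_1-j_2}X_{j_1+j_2})\times\cdots\times\Re(\overline{X}_{-j_1-\dots-j_{m-1}-1}\cdots\overline{X}_{-n}X_n)\Big)=4^{\,n-m}\sum_{\Gamma\in\mathcal{M}}(-2)^{\chi(\Gamma)},$$ where $\chi(\Gamma)$ is the Euler characteristic of $\Gamma$ and the right-hand side is interpreted as $0$ when $\mathcal{M}=\emptyset$.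
   Context: Quaternions: $\mathbb{H}\ni q=x_0+ix_1+jx_2+kx_3$ with $i^2=j^2=k^2=ijk=-1$, $x_0,\dots,x_3\in\mathbb{R}$; $\overline q=x_0-ix_1-jx_2-kx_3$; $\Re(q)=(q+\overline q)/2=x_0$. A standard quaternion Gaussian random variable is $Z=\xi_0+i\xi_1+j\xi_2+k\xi_3$ with $\xi_0,\xi_1,\xi_2,\xi_3$ independent real $N(0,1)$ random variables. Bipartite Möbius graphs are built from three pair partitions (partitions into two-element sets) of the set $\{\pm1,\dots,\pm n\}$: (1) $\delta$ consists of the pairs $\{j,-j\}$, $1\le j\le n$; (2) $\sigma$ (describing the placement of $\Re$) consists, for each block of consecutive integers $\alpha_r=j_1+\dots+j_{r-1}+1,\dots,\beta_r=j_1+\dots+j_r$, $r=1,\dots,m$, of the pairs $\{\alpha_r,-(\alpha_r+1)\},\{\alpha_r+1,-(\alpha_r+2)\},\dots,\{\beta_r-1,-\beta_r\},\{\beta_r,-\alpha_r\}$; (3) $\gamma$ is a pair partition such that $X_j$ and $X_k$ are the same variable $Z_l$ for every pair $\{j,k\}\in\gamma$. The bipartite Möbius graph $\Gamma$ determined by $\gamma$ has one black vertex for each of the $m$ cycles of the 2-regular (multi)graph $\delta\cup\sigma$, one white vertex for each cycle of $\delta\cup\gamma$, and $n$ edges (ribbons), the $j$-th ribbon having its two sides labeled $j$ and $-j$ and joining the black vertex whose cycle contains $\{j,-j\}$ to the white vertex whose cycle contains $\{j,-j\}$. Black vertices are oriented counterclockwise and white vertices clockwise, the labeled lines around a vertex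 being drawn following its cycle; a ribbon is twisted if the order of its two sides $-j,j$ at the black vertex does not match their order at the white vertex. Graphs that differ only by a choice of orientation at some white vertices (twists propagated through a white vertex) are identified. Faces are the cycles obtained by following the sides of the ribbons through the vertices; equivalently, they are the cycles of the 2-regular (multi)graph $\sigma\cup\gamma$. Euler characteristic: $\chi(\Gamma)=v(\Gamma)-e(\Gamma)+f(\Gamma)$, where $v(\Gamma)$ is the total number of vertices, i.e. $m$ plus the number of white vertices (cycles of $\delta\cup\gamma$), $e(\Gamma)=n$ is the number of edges, and $f(\Gamma)$ is the number of faces (cycles of $\sigma\cup\gamma$). The graph need not be connected. The set $\mathcal{M}$ has exactly one element for each pair partition $\gamma$ satisfying (3); in particular $\mathcal{M}=\emptyset$ if some $Z_l$ is repeated an odd number of times. *)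

theory Defs
  imports "HOL-Probability.Probability"
begin

section \<open>Quaternions\<close>

datatype quat = Quat (qre: real) (qi: real) (qj: real) (qk: real)

instantiation quat :: ring_1
begin

definition "0 = Quat 0 0 0 0"
definition "1 = Quat 1 0 0 0"
definition "p + q = Quat (qre p + qre q) (qi p + qi q) (qj p + qj q) (qk p + qk q)"
definition "p - q = Quat (qre p - qre q) (qi p - qi q) (qj p - qj q) (qk p - qk q)"
definition "- q = Quat (- qre q) (- qi q) (- qj q) (- qk q)"
definition "p * q = Quat
  (qre p * qre q - qi p * qi q - qj p * qj q - qk p * qk q)
  (qre p * qi q + qi p * qre q + qj p * qk q - qk p * qj q)
  (qre p * qj q - qi p * qk q + qj p * qre q + qk p * qi q)
  (qre p * qk q + qi p * qj q - qj p * qi q + qk p * qre q)"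

instance
  by standard
    (auto simp: zero_quat_def one_quat_def plus_quat_def minus_quat_def uminus_quat_def
      times_quat_def algebra_simps)

end

lemma quat_units:
  "Quat 0 1 0 0 * Quat 0 1 0 0 = -1"
  "Quat 0 0 1 0 * Quat 0 0 1 0 = -1"
  "Quat 0 0 0 1 * Quat 0 0 0 1 = -1"
  "Quat 0 1 0 0 * Quat 0 0 1 0 * Quat 0 0 0 1 = -1"
  by (simp_all add: times_quat_def uminus_quat_def one_quat_def)

definition qcnj :: "quat \<Rightarrow> quat" where
  "qcnj q = Quat (qre q) (- qi q) (- qj q) (- qk q)"

text \<open>The topology of \<open>\<real>\<^sup>4\<close>; it provides the Borel sets used for quaternion random variables.\<close>

instantiation quat :: topological_space
begin

definition open_quat :: "quat set \<Rightarrow> bool" where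
  "open_quat U \<longleftrightarrow> open ((\<lambda>(a, b, c, d). Quat a b c d) -` U)"

instance
  by standard (simp_all add: open_quat_def vimage_Union open_Int open_UN vimage_Int)

end

text \<open>The four coordinates are indexed by the (pairwise distinct) coordinate projections.\<close>

definition (in prob_space) std_quat_gaussian :: "('a \<Rightarrow> quat) \<Rightarrow> bool" where
  "std_quat_gaussian Z \<longleftrightarrow>
     indep_vars (\<lambda>_. borel) (\<lambda>c \<omega>. c (Z \<omega>)) {qre, qi, qj, qk} \<and>
     (\<forall>c \<in> {qre, qi, qj, qk}. distributed M lborel (\<lambda>\<omega>. c (Z \<omega>)) std_normal_density)"


section \<open>Pair partitions\<close>

definition pair_partition :: "'a set \<Rightarrow> 'a set set \<Rightarrow> bool" where
  "pair_partition A P \<longleftrightarrow> partition_on A P \<and> (\<forall>B\<in>P. card B = 2)"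

definition labels :: "nat \<Rightarrow> int set" where
  "labels n = {- int n..int n} - {0}"

definition delta :: "nat \<Rightarrow> int set set" where
  "delta n = {{k, - k} | k. k \<in> {1..int n}}"

definition block_first :: "(nat \<Rightarrow> nat) \<Rightarrow> nat \<Rightarrow> int" where
  "block_first j r = int (\<Sum>s=1..<r. j s) + 1"

definition block_last :: "(nat \<Rightarrow> nat) \<Rightarrow> nat \<Rightarrow> int" where
  "block_last j r = int (\<Sum>s=1..r. j s)"

definition sigma :: "nat \<Rightarrow> (nat \<Rightarrow> nat) \<Rightarrow> int set set" where
  "sigma m j = (\<Union>r\<in>{1..m}.
     {{k, - (k + 1)} | k. block_first j r \<le> k \<and> k < block_last j r} \<union>
     {{block_last j r, - block_first j r}})"


section \<open>Bipartite Moebius graphs\<close>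

text \<open>
  For pair partitions \<open>P\<close> and \<open>Q\<close> of the same set, \<open>P \<union> Q\<close> is read as a 2-regular multigraph:
  a pair lying in both \<open>P\<close> and \<open>Q\<close> is a double edge. A cycle, that is a connected nonempty
  2-regular subgraph, is kept as the pair \<open>(D, E)\<close> of its edges from \<open>P\<close> and its edges from \<open>Q\<close>.
  Since a vertex lies on at most one edge of each kind, it has degree two in the subgraph
  iff it lies on an edge of both kinds, whence the condition \<open>\<Union>D = \<Union>E\<close>.
\<close>

type_synonym 'a cycle = "'a set set \<times> 'a set set"

definition cycles :: "'a set set \<Rightarrow> 'a set set \<Rightarrow> 'a cycle set" where
  "cycles P Q = {(D, E). D \<subseteq> P \<and> E \<subseteq> Q \<and> \<Union>D = \<Union>E \<and> \<Union>D \<noteq> {} \<and>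
     (\<forall>x\<in>\<Union>D. \<forall>y\<in>\<Union>D. (x, y) \<in> {(a, b). {a, b} \<in> D \<union> E}\<^sup>*)}"

text \<open>
  A direction of travel along every cycle of \<open>\<delta> \<union> \<gamma>\<close>, given by the set \<open>F\<close> of those sides
  that are met first when a ribbon is passed: one side of each ribbon is met first, and a pair of
  \<open>\<gamma>\<close> leads from the second side of a ribbon to the first side of the next one.
\<close>

definition white_orientation :: "nat \<Rightarrow> int set set \<Rightarrow> int set \<Rightarrow> bool" where
  "white_orientation n \<gamma> F \<longleftrightarrow>
     F \<subseteq> labels n \<and> (\<forall>B \<in> delta n. card (B \<inter> F) = 1) \<and> (\<forall>B \<in> \<gamma>. card (B \<inter> F) = 1)"

text \<open>
  At a black vertex the cycle is followed in the direction given by \<open>\<sigma>\<close>, so that side \<open>-k\<close> always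
  precedes side \<open>k\<close>; the ribbon \<open>k\<close> is twisted iff this is not so at its white vertex.
\<close>

definition twisted_ribbons :: "nat \<Rightarrow> int set \<Rightarrow> int set" where
  "twisted_ribbons n F = {k \<in> {1..int n}. - k \<notin> F}"

text \<open>
  Vertices are cycles of side labels. A ribbon is recorded with its black and its white end.
  Graphs that differ by the orientation of some white vertices are identified, so the component
  \<open>twists\<close> collects the sets of twisted ribbons over all choices of these orientations.
\<close>

record moebius_graph =
  black_vertices :: "int cycle set"
  white_vertices :: "int cycle set"
  ribbons :: "(int \<times> int cycle \<times> int cycle) set"
  twists :: "int set set"

definition moebius_graph_of ::
    "nat \<Rightarrow> nat \<Rightarrow> (nat \<Rightarrow> nat) \<Rightarrow> int set set \<Rightarrow> moebius_graph" where
  "moebius_graph_of n m j \<gamma> =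
     \<lparr>black_vertices = cycles (delta n) (sigma m j),
      white_vertices = cycles (delta n) \<gamma>,
      ribbons = {(k, b, w). k \<in> {1..int n} \<and>
        b \<in> cycles (delta n) (sigma m j) \<and> {k, - k} \<in> fst b \<and>
        w \<in> cycles (delta n) \<gamma> \<and> {k, - k} \<in> fst w},
      twists = {twisted_ribbons n F | F. white_orientation n \<gamma> F}\<rparr>"

text \<open>
  A face runs along a side of a ribbon, through a corner of a white vertex to the side of another
  ribbon, along that side, and through a corner of a black vertex. The corners of the black
  vertices are the pairs of \<open>\<sigma>\<close>, those of the white vertices the pairs of \<open>\<gamma>\<close>.
\<close>

definition faces :: "moebius_graph \<Rightarrow> int cycle set" where
  "faces G = cycles (\<Union>(snd ` black_vertices G)) (\<Union>(snd ` white_vertices G))"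

definition euler_char :: "moebius_graph \<Rightarrow> int" where
  "euler_char G = int (card (black_vertices G) + card (white_vertices G))
     - int (card (ribbons G)) + int (card (faces G))"

text \<open>Here \<open>X\<^sub>a\<close> is the variable \<open>Z\<^sub>l\<close> with \<open>l = t a\<close>.\<close>

definition moebius_graphs ::
    "nat \<Rightarrow> nat \<Rightarrow> (nat \<Rightarrow> nat) \<Rightarrow> (int \<Rightarrow> nat) \<Rightarrow> moebius_graph set" where
  "moebius_graphs n m j t =
     moebius_graph_of n m j `
       {\<gamma>. pair_partition (labels n) \<gamma> \<and> (\<forall>a b. {a, b} \<in> \<gamma> \<longrightarrow> t a = t b)}"

end

theory Submission
  imports Defs
begin

text \<open>
  Identify a quaternion with a complex \<open>2 \<times> 2\<close> matrix. Then \<open>Re\<close> is half the trace, and conjugation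
  is the adjugate, that is, transposition combined with the antisymmetric form \<open>\<epsilon>\<close> on both
  indices. Writing every trace as a sum over indices gives, to each label \<open>a\<close>, a row index
  \<open>\<rho> a\<close> and a column index \<open>\<kappa> a\<close>; the two sides of a ribbon (pairs of \<open>\<delta>\<close>) have their row
  indices contracted by \<open>\<epsilon>\<close>, and the two labels of a black corner (pairs of \<open>\<sigma>\<close>) have their
  column indices contracted by \<open>\<epsilon>\<close> (lemma \<open>trace_product_expansion\<close>).

  By Wick's formula (\<open>gaussian_wick\<close>) the expectation is the sum over all compatible pairings
  \<open>\<gamma>\<close> of the value obtained by replacing the entries at each pair of \<open>\<gamma>\<close> with their covariance.
  The covariance of two matrix entries is \<open>2 \<epsilon> \<epsilon>\<close>, one \<open>\<epsilon>\<close> for the rows and one for the columns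
  (\<open>unit_mat_covariance\<close>). Hence the contribution of \<open>\<gamma>\<close> factors into a sum over \<open>\<rho>\<close>, in which
  \<open>\<epsilon>\<close> is contracted along \<open>\<delta> \<union> \<gamma>\<close>, and a sum over \<open>\<kappa>\<close>, in which it is contracted along
  \<open>\<sigma> \<union> \<gamma>\<close>. Up to sign each such sum is a power of two with the number of cycles as its exponent, and
  the cycles of the two graphs are the white vertices and the faces.

  It remains to control the signs. If the pairs of \<open>P\<close> and \<open>Q\<close> are ordered, and \<open>p\<close>, \<open>q\<close> are the
  permutations that carry the pairs \<open>(-k, k)\<close> to those of \<open>P\<close> and \<open>Q\<close>, then the contraction along
  \<open>P \<union> Q\<close> is \<open>sgn p \<cdot> sgn q \<cdot> (-1)\<^sup>n \<cdot> (-2)\<^sup>c\<close>, where \<open>c\<close> is the number of cycles (\<open>overlap_eps\<close>). This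
  is proved by contracting one pair at a time. In the product of the two sums the sign of \<open>\<gamma>\<close>
  cancels, and the sign of \<open>\<sigma>\<close> is \<open>(-1)\<^sup>m\<close>, because the non-zero terms of the contraction
  along \<open>\<delta> \<union> \<sigma>\<close> all have the same sign (\<open>sgn_rot\<close>). What is left is \<open>4\<^bsup>n-m\<^esup> (-2)\<^bsup>\<chi>\<^esup>\<close>.
\<close>

section \<open>Pairings and Gaussian moments\<close>

definition pairings :: "('a \<Rightarrow> 'b) \<Rightarrow> 'a set \<Rightarrow> 'a set set set" where
  "pairings v A = {\<gamma>. pair_partition A \<gamma> \<and> (\<forall>a b. {a, b} \<in> \<gamma> \<longrightarrow> v a = v b)}"

lemma pair_partition_insert:
  assumes "pair_partition (A - {a, b}) \<gamma>" "a \<in> A" "b \<in> A" "a \<noteq> b"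
  shows "pair_partition A (insert {a, b} \<gamma>)"
  using assms unfolding pair_partition_def partition_on_def
  by (auto simp: disjoint_def)

lemma pair_partition_remove:
  assumes "pair_partition A \<gamma>" "{a, b} \<in> \<gamma>"
  shows "pair_partition (A - {a, b}) (\<gamma> - {{a, b}})"
proof -
  have dis: "disjoint \<gamma>" "\<Union>\<gamma> = A" "{} \<notin> \<gamma>" and c: "\<forall>B\<in>\<gamma>. card B = 2"
    using assms by (auto simp: pair_partition_def partition_on_def)
  have "\<Union>(\<gamma> - {{a, b}}) = A - {a, b}"
    using dis assms(2) by (force simp: disjoint_def)
  thus ?thesis using dis c by (auto simp: pair_partition_def partition_on_def disjoint_def)
qed

lemma pair_partition_partner:
  assumes "pair_partition A \<gamma>" "a \<in> A"
  obtains b where "{a, b} \<in> \<gamma>" "b \<in> A" "b \<noteq> a"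
proof -
  obtain B where B: "B \<in> \<gamma>" "a \<in> B"
    using assms by (auto simp: pair_partition_def partition_on_def)
  then have "card B = 2" using assms by (auto simp: pair_partition_def)
  then obtain x y where xy: "B = {x, y}" "x \<noteq> y" by (auto simp: card_2_iff)
  have "B \<subseteq> A" using B assms by (auto simp: pair_partition_def partition_on_def)
  have "{a, x} = B \<and> x \<noteq> a \<or> {a, y} = B \<and> y \<noteq> a" using xy B by auto
  thus ?thesis using that B \<open>B \<subseteq> A\<close> xy by blast
qed

lemma pair_partition_unique:
  assumes "pair_partition A \<gamma>" "B \<in> \<gamma>" "C \<in> \<gamma>" "x \<in> B" "x \<in> C"
  shows "B = C"
  using assms by (auto simp: pair_partition_def partition_on_def disjoint_def)

lemma pair_partition_pair:
  assumes "pair_partition A \<gamma>" "B \<in> \<gamma>"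
  obtains a b where "B = {a, b}" "a \<noteq> b" "a \<in> A" "b \<in> A"
proof -
  from assms have "card B = 2" by (auto simp: pair_partition_def)
  then obtain x y where xy: "B = {x, y}" "x \<noteq> y" by (auto simp: card_2_iff)
  have "B \<subseteq> A" using assms by (auto simp: pair_partition_def partition_on_def)
  thus ?thesis using that xy by auto
qed

lemma finite_pairings:
  assumes "finite A" shows "finite (pairings v A)"
proof (rule finite_subset)
  show "pairings v A \<subseteq> Pow (Pow A)"
    by (auto simp: pairings_def pair_partition_def partition_on_def)
qed (use assms in auto)

lemma pairings_empty: "pairings v {} = {{}}"
  by (auto simp: pairings_def pair_partition_def partition_on_def disjoint_def)

text \<open>
  A pairing is determined by the partner \<open>b\<close> of a chosen point \<open>a\<close> and the pairing induced on the
  remaining points. This is the recursion that matches the moments of the normal distribution.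
\<close>
lemma pairings_rec:
  assumes "a \<in> A"
  shows "pairings v A =
    (\<Union>b\<in>{b \<in> A - {a}. v b = v a}. insert {a, b} ` pairings v (A - {a, b}))" (is "_ = ?R")
proof (intro equalityI subsetI)
  fix \<gamma> assume g: "\<gamma> \<in> pairings v A"
  then have pp: "pair_partition A \<gamma>" by (simp add: pairings_def)
  obtain b where b: "{a, b} \<in> \<gamma>" "b \<in> A" "b \<noteq> a" using pair_partition_partner[OF pp assms] .
  have "\<gamma> - {{a, b}} \<in> pairings v (A - {a, b})"
    using g pair_partition_remove[OF pp b(1)] by (auto simp: pairings_def)
  moreover have "\<gamma> = insert {a, b} (\<gamma> - {{a, b}})" using b by auto
  moreover have "v b = v a" using g b by (auto simp: pairings_def)
  ultimately show "\<gamma> \<in> ?R" using b by blast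
next
  fix \<gamma> assume "\<gamma> \<in> ?R"
  then obtain b \<gamma>' where b: "b \<in> A" "b \<noteq> a" "v b = v a" "\<gamma> = insert {a, b} \<gamma>'"
    "\<gamma>' \<in> pairings v (A - {a, b})" by auto
  then show "\<gamma> \<in> pairings v A"
    using pair_partition_insert[of A a b \<gamma>'] assms
    by (auto simp: pairings_def doubleton_eq_iff)
qed

lemma card_pairings_rec:
  assumes "finite A" "a \<in> A"
  shows "card (pairings v A) = (\<Sum>b\<in>{b \<in> A - {a}. v b = v a}. card (pairings v (A - {a, b})))"
proof -
  let ?B = "{b \<in> A - {a}. v b = v a}"
  have notin: "{a, b} \<notin> \<gamma>" if "\<gamma> \<in> pairings v (A - {a, c})" for b c \<gamma>
    using that by (auto simp: pairings_def pair_partition_def partition_on_def)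
  have "card (pairings v A) = (\<Sum>b\<in>?B. card (insert {a, b} ` pairings v (A - {a, b})))"
    unfolding pairings_rec[OF assms(2), of v]
  proof (rule card_UN_disjoint)
    show "\<forall>b\<in>?B. \<forall>c\<in>?B. b \<noteq> c \<longrightarrow> insert {a, b} ` pairings v (A - {a, b}) \<inter>
        insert {a, c} ` pairings v (A - {a, c}) = {}"
    proof (intro ballI impI, rule ccontr)
      fix b c assume bc: "b \<in> ?B" "c \<in> ?B" "b \<noteq> c"
        and "insert {a, b} ` pairings v (A - {a, b}) \<inter> insert {a, c} ` pairings v (A - {a, c}) \<noteq> {}"
      then obtain g h where gh: "g \<in> pairings v (A - {a, b})" "h \<in> pairings v (A - {a, c})"
        "insert {a, b} g = insert {a, c} h" by auto
      then have "{a, b} \<in> insert {a, c} h" by auto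
      then show False using bc notin[OF gh(2), of b] by (auto simp: doubleton_eq_iff)
    qed
    show "\<forall>b\<in>?B. finite (insert {a, b} ` pairings v (A - {a, b}))"
      using assms by (intro ballI finite_imageI finite_pairings) auto
  qed (use assms in auto)
  also have "\<dots> = (\<Sum>b\<in>?B. card (pairings v (A - {a, b})))"
  proof (intro sum.cong refl card_image inj_onI)
    fix b g h assume "g \<in> pairings v (A - {a, b})" "h \<in> pairings v (A - {a, b})"
      "insert {a, b} g = insert {a, b} h"
    then show "g = h" using notin[of _ b b] by (metis insert_ident)
  qed
  finally show ?thesis .
qed

definition normal_moment :: "nat \<Rightarrow> real" where
  "normal_moment k = (\<integral>x. std_normal_density x * x ^ k \<partial>lborel)"

lemma normal_moment_0: "normal_moment 0 = 1"
  using integral_std_normal_moment_even[of 0] by (simp add: normal_moment_def)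

lemma normal_moment_1: "normal_moment (Suc 0) = 0"
  using integral_std_normal_moment_odd[of 0] by (simp add: normal_moment_def)

lemma normal_moment_Suc_Suc: "normal_moment (Suc (Suc k)) = real (Suc k) * normal_moment k"
proof (cases "even k")
  case True
  then obtain l where l: "k = 2 * l" by (elim evenE)
  have "normal_moment (Suc (Suc k)) = fact (2 * Suc l) / (2 ^ Suc l * fact (Suc l))"
    using integral_std_normal_moment_even[of "Suc l"] by (simp add: normal_moment_def l)
  also have "\<dots> = real (Suc k) * (fact (2 * l) / (2 ^ l * fact l))"
  proof -
    have "real l + 1 > 0" by simp
    then have "(1 + 2 * real l) * (2 + 2 * real l) / (2 * (1 + real l)) = 1 + 2 * real l"
      by (simp add: divide_simps)
    moreover have "fact (2 * Suc l) / (2 ^ Suc l * fact (Suc l)) =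
        ((1 + 2 * real l) * (2 + 2 * real l) / (2 * (1 + real l))) *
          (fact (2 * l) / (2 ^ l * fact l) :: real)"
    proof -
      have "fact (2 * Suc l) = ((1 + 2 * real l) * (2 + 2 * real l)) * fact (2 * l)"
        "2 ^ Suc l * fact (Suc l) = (2 * (1 + real l)) * (2 ^ l * fact l)"
        by (simp_all add: algebra_simps)
      then show ?thesis by (simp only: times_divide_times_eq)
    qed
    ultimately show ?thesis by (simp add: l)
  qed
  also have "(fact (2 * l) / (2 ^ l * fact l)) = normal_moment k"
    using integral_std_normal_moment_even[of l] by (simp add: normal_moment_def l)
  finally show ?thesis .
next
  case False
  then obtain l where l: "k = 2 * l + 1" by (elim oddE)
  show ?thesis
    using integral_std_normal_moment_odd[of l] integral_std_normal_moment_odd[of "Suc l"]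
    by (simp add: normal_moment_def l)
qed

text \<open>
  The \<open>k\<close>-th moment counts the pairings of \<open>k\<close> points, and a pairing compatible with \<open>v\<close> is a family
  of pairings of the fibres of \<open>v\<close>. The induction removes a point and its partner: the fibre of size
  \<open>k\<close> offers \<open>k - 1\<close> partners, and the moments satisfy the recursion with the same factor.
\<close>
lemma card_pairings_eq_prod_moments:
  assumes "finite A" "finite V" "v ` A \<subseteq> V"
  shows "real (card (pairings v A)) = (\<Prod>w\<in>V. normal_moment (card {a \<in> A. v a = w}))"
  using assms(1,3)
proof (induction "card A" arbitrary: A rule: less_induct)
  case (less A)
  show ?case
  proof (cases "A = {}")
    case True
    then show ?thesis by (simp add: pairings_empty normal_moment_0)
  next
    case False
    then obtain a where a: "a \<in> A" by blast
    let ?F = "\<lambda>A w. {a \<in> A. v a = w}"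
    let ?B = "{b \<in> A - {a}. v b = v a}"
    define R where "R = (\<Prod>w\<in>V - {v a}. normal_moment (card (?F A w)))"
    have va: "v a \<in> V" using a less.prems by auto
    have step: "real (card (pairings v (A - {a, b}))) = normal_moment (card (?F A (v a)) - 2) * R"
      if b: "b \<in> ?B" for b
    proof -
      have "card (A - {a, b}) < card A"
        using a less.prems(1) by (intro psubset_card_mono) auto
      then have "real (card (pairings v (A - {a, b}))) =
          (\<Prod>w\<in>V. normal_moment (card (?F (A - {a, b}) w)))"
        using less.prems by (intro less.hyps) auto
      also have "\<dots> = normal_moment (card (?F (A - {a, b}) (v a))) *
          (\<Prod>w\<in>V - {v a}. normal_moment (card (?F (A - {a, b}) w)))"
        using assms(2) va by (simp add: prod.remove)
      also have "?F (A - {a, b}) (v a) = ?F A (v a) - {a, b}" by auto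
      also have "card \<dots> = card (?F A (v a)) - 2"
        using a b less.prems(1) by (subst card_Diff_subset) auto
      also have "(\<Prod>w\<in>V - {v a}. normal_moment (card (?F (A - {a, b}) w))) = R"
        unfolding R_def using b by (intro prod.cong refl arg_cong[where f = normal_moment]
            arg_cong[where f = card]) auto
      finally show ?thesis .
    qed
    have cB: "card ?B = card (?F A (v a)) - 1"
    proof -
      have "?B = ?F A (v a) - {a}" by auto
      then show ?thesis using a by simp
    qed
    have "real (card (pairings v A)) = real (card ?B) * (normal_moment (card (?F A (v a)) - 2) * R)"
      unfolding card_pairings_rec[OF less.prems(1) a] using step by (simp del: mem_Collect_eq)
    also have "\<dots> = normal_moment (card (?F A (v a))) * R"
    proof (cases "card ?B")
      case 0
      have "card (?F A (v a)) > 0" using a less.prems(1) by (auto simp: card_gt_0_iff)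
      then have "card (?F A (v a)) = 1" using 0 cB by linarith
      then show ?thesis using 0 by (simp add: normal_moment_1)
    next
      case (Suc k)
      then have "card (?F A (v a)) = Suc (Suc k)" using cB by simp
      then show ?thesis using Suc by (simp add: normal_moment_Suc_Suc)
    qed
    also have "\<dots> = (\<Prod>w\<in>V. normal_moment (card (?F A w)))"
      unfolding R_def using assms(2) va by (simp add: prod.remove)
    finally show ?thesis .
  qed
qed

text \<open>
  The coordinates are indexed by the projections themselves, as in the definition of a standard
  quaternion Gaussian variable.
\<close>
definition coords :: "(quat \<Rightarrow> real) set" where "coords = {qre, qi, qj, qk}"

lemma coords_distinct: "distinct [qre, qi, qj, qk]"
proof -
  have "qre (Quat 1 2 3 4) = 1" "qi (Quat 1 2 3 4) = 2" "qj (Quat 1 2 3 4) = 3"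
    "qk (Quat 1 2 3 4) = 4" by simp_all
  then show ?thesis by (auto simp del: quat.sel)
qed

lemma finite_coords: "finite coords" by (simp add: coords_def)

lemma sum_coords: "(\<Sum>d\<in>coords. f d) = f qre + f qi + f qj + f qk"
  using coords_distinct by (simp add: coords_def add.assoc)

lemma coord_borel_measurable:
  assumes "d \<in> coords" shows "d \<in> borel_measurable borel"
proof (intro borel_measurable_continuous_onI)
  have "open (d -` U)" if "open U" for U
  proof -
    have *: "(\<lambda>(a, b, c, d). Quat a b c d) -` qre -` U = U \<times> UNIV"
      "(\<lambda>(a, b, c, d). Quat a b c d) -` qi -` U = UNIV \<times> U \<times> UNIV"
      "(\<lambda>(a, b, c, d). Quat a b c d) -` qj -` U = UNIV \<times> UNIV \<times> U \<times> UNIV"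
      "(\<lambda>(a, b, c, d). Quat a b c d) -` qk -` U = UNIV \<times> UNIV \<times> UNIV \<times> U"
      by auto
    show ?thesis using assms that unfolding coords_def open_quat_def
      by (auto simp only: * insert_iff empty_iff intro!: open_Times open_UNIV)
  qed
  then show "continuous_on UNIV d" by (simp add: continuous_on_open_vimage)
qed

context prob_space begin

lemma std_normal_power:
  assumes "distributed M lborel Y std_normal_density"
  shows "integrable M (\<lambda>\<omega>. Y \<omega> ^ k)" and "expectation (\<lambda>\<omega>. Y \<omega> ^ k) = normal_moment k"
  using distributed_integrable[OF assms, of "\<lambda>x. x ^ k"] integrable_std_normal_moment[of k]
    distributed_integral[OF assms, of "\<lambda>x. x ^ k"]
  by (auto simp: normal_moment_def)

lemma prod_by_fibres:
  assumes "finite A" "finite V" "v ` A \<subseteq> V"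
  shows "(\<Prod>a\<in>A. f (v a)) = (\<Prod>w\<in>V. f w ^ card {a \<in> A. v a = w})"
  using prod.group[OF assms, of "\<lambda>a. f (v a)"] by simp

text \<open>
  Wick's formula for monomials in the real coordinates. Independence splits the expectation into
  one moment for each pair of a variable and a coordinate, and
  \<open>card_pairings_eq_prod_moments\<close> recognises the product of these moments.
\<close>
lemma gaussian_wick:
  assumes Z: "indep_vars (\<lambda>_. borel) Z L" "\<And>l. l \<in> L \<Longrightarrow> std_quat_gaussian (Z l)"
    and fin: "finite L" "finite A" and t: "t ` A \<subseteq> L" and c: "c ` A \<subseteq> coords"
  shows "integrable M (\<lambda>\<omega>. \<Prod>a\<in>A. c a (Z (t a) \<omega>))"
    and "expectation (\<lambda>\<omega>. \<Prod>a\<in>A. c a (Z (t a) \<omega>)) = card (pairings (\<lambda>a. (t a, c a)) A)"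
proof -
  let ?v = "\<lambda>a. (t a, c a)"
  define N where "N l d = card {a \<in> A. ?v a = (l, d)}" for l d
  define Y where "Y l q = (\<Prod>d\<in>coords. d q ^ N l d)" for l q
  have meas: "Y l \<in> borel_measurable borel" for l
    unfolding Y_def using coord_borel_measurable by (intro borel_measurable_prod borel_measurable_power) auto
  have eq: "(\<Prod>a\<in>A. c a (Z (t a) \<omega>)) = (\<Prod>l\<in>L. Y l (Z l \<omega>))" for \<omega>
  proof -
    have "(\<Prod>a\<in>A. c a (Z (t a) \<omega>)) = (\<Prod>a\<in>A. (\<lambda>(l, d). d (Z l \<omega>)) (?v a))" by simp
    also have "\<dots> = (\<Prod>w\<in>L \<times> coords. (\<lambda>(l, d). d (Z l \<omega>)) w ^ card {a \<in> A. ?v a = w})"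
      using fin t c finite_coords by (intro prod_by_fibres) auto
    also have "\<dots> = (\<Prod>l\<in>L. Y l (Z l \<omega>))"
      unfolding Y_def N_def by (subst prod.cartesian_product) (auto intro!: prod.cong)
    finally show ?thesis .
  qed
  have one: "integrable M (\<lambda>\<omega>. Y l (Z l \<omega>))"
    "expectation (\<lambda>\<omega>. Y l (Z l \<omega>)) = (\<Prod>d\<in>coords. normal_moment (N l d))" if l: "l \<in> L" for l
  proof -
    have g: "indep_vars (\<lambda>_. borel) (\<lambda>d \<omega>. d (Z l \<omega>)) coords"
      "\<And>d. d \<in> coords \<Longrightarrow> distributed M lborel (\<lambda>\<omega>. d (Z l \<omega>)) std_normal_density"
      using Z(2)[OF l] by (auto simp: std_quat_gaussian_def coords_def)
    have ind: "indep_vars (\<lambda>_. borel) (\<lambda>d \<omega>. d (Z l \<omega>) ^ N l d) coords"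
      by (rule indep_vars_compose2[OF g(1)]) simp
    note sp = std_normal_power[OF g(2)]
    show "integrable M (\<lambda>\<omega>. Y l (Z l \<omega>))"
      unfolding Y_def using sp by (intro indep_vars_integrable[OF finite_coords ind])
    show "expectation (\<lambda>\<omega>. Y l (Z l \<omega>)) = (\<Prod>d\<in>coords. normal_moment (N l d))"
      unfolding Y_def using sp by (subst indep_vars_lebesgue_integral[OF finite_coords ind]) auto
  qed
  have ind: "indep_vars (\<lambda>_. borel) (\<lambda>l \<omega>. Y l (Z l \<omega>)) L"
    by (rule indep_vars_compose2[OF Z(1)]) (rule meas)
  show "integrable M (\<lambda>\<omega>. \<Prod>a\<in>A. c a (Z (t a) \<omega>))"
    unfolding eq using one by (intro indep_vars_integrable[OF fin(1) ind])
  have "expectation (\<lambda>\<omega>. \<Prod>a\<in>A. c a (Z (t a) \<omega>)) = (\<Prod>l\<in>L. \<Prod>d\<in>coords. normal_moment (N l d))"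
    unfolding eq using one by (subst indep_vars_lebesgue_integral[OF fin(1) ind]) auto
  also have "\<dots> = (\<Prod>w\<in>L \<times> coords. normal_moment (card {a \<in> A. ?v a = w}))"
    unfolding N_def by (subst prod.cartesian_product) (auto intro!: prod.cong)
  also have "\<dots> = card (pairings ?v A)"
    using fin t c finite_coords by (subst card_pairings_eq_prod_moments) auto
  finally show "expectation (\<lambda>\<omega>. \<Prod>a\<in>A. c a (Z (t a) \<omega>)) = card (pairings ?v A)" .
qed

end

section \<open>Contracting a bilinear form along two matchings\<close>

lemma sum_PiE_insert:
  assumes "x \<notin> A"
  shows "(\<Sum>f\<in>insert x A \<rightarrow>\<^sub>E K. F f) = (\<Sum>f\<in>A \<rightarrow>\<^sub>E K. \<Sum>y\<in>K. F (f(x := y)))"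
proof -
  have "(\<Sum>f\<in>insert x A \<rightarrow>\<^sub>E K. F f) = (\<Sum>(y, f)\<in>K \<times> (A \<rightarrow>\<^sub>E K). F (f(x := y)))"
    unfolding PiE_insert_eq
    by (subst sum.reindex[OF inj_combinator[OF assms]]) (auto simp: case_prod_unfold)
  also have "\<dots> = (\<Sum>y\<in>K. \<Sum>f\<in>A \<rightarrow>\<^sub>E K. F (f(x := y)))"
    by (rule sum.cartesian_product[symmetric])
  finally show ?thesis by (subst sum.swap)
qed

lemma sum_PiE_permute:
  assumes "p permutes A"
  shows "(\<Sum>f\<in>A \<rightarrow>\<^sub>E K. F (restrict (f \<circ> p) A)) = (\<Sum>f\<in>A \<rightarrow>\<^sub>E K. F f)"
  by (rule sum.reindex_bij_witness[where i = "\<lambda>f. restrict (f \<circ> inv p) A" and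
        j = "\<lambda>f. restrict (f \<circ> p) A"])
    (auto simp: fun_eq_iff permutes_inverses[OF assms] permutes_in_image[OF assms]
      permutes_in_image[OF permutes_inv[OF assms]] restrict_def PiE_def extensional_def Pi_def)

definition sides :: "int set \<Rightarrow> int set" where
  "sides I = I \<union> uminus ` I"

lemma sides_insert: "sides (insert i I) = insert i (insert (- i) (sides I))"
  by (auto simp: sides_def)

text \<open>
  A symmetric (\<open>\<eta> = 1\<close>) or antisymmetric (\<open>\<eta> = -1\<close>) bilinear form on a two-dimensional space whose
  matrix is orthogonal. Two instances matter: equality of indices counts the cycles of a graph, and
  \<open>\<epsilon>\<close> adds the signs; treating them together ensures that both see the same number of cycles.
\<close>
definition unit_form :: "(bool \<Rightarrow> bool \<Rightarrow> complex) \<Rightarrow> complex \<Rightarrow> bool" where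
  "unit_form \<beta> \<eta> \<longleftrightarrow> \<eta> \<in> {1, -1} \<and> (\<forall>x y. \<beta> y x = \<eta> * \<beta> x y) \<and>
     (\<forall>x z. (\<Sum>y\<in>UNIV. \<beta> x y * \<beta> z y) = of_bool (x = z))"

lemma unit_formD:
  assumes "unit_form \<beta> \<eta>"
  shows "\<eta> \<in> {1, -1}" "\<beta> y x = \<eta> * \<beta> x y" "(\<Sum>y\<in>UNIV. \<beta> x y * \<beta> z y) = of_bool (x = z)"
  using assms unfolding unit_form_def by blast+

definition eps :: "bool \<Rightarrow> bool \<Rightarrow> complex" where
  "eps x y = of_bool (\<not> x \<and> y) - of_bool (x \<and> \<not> y)"

definition same :: "bool \<Rightarrow> bool \<Rightarrow> complex" where
  "same x y = of_bool (x = y)"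

lemma unit_form_eps: "unit_form eps (-1)"
  unfolding unit_form_def by (auto simp: eps_def UNIV_bool)

lemma unit_form_same: "unit_form same 1"
  unfolding unit_form_def by (auto simp: same_def UNIV_bool)

text \<open>
  The form is contracted along the pairs \<open>{-k, k}\<close> and along their images under a permutation \<open>p\<close>.
  The permutation carries, besides the second matching, an order of each of its pairs.
\<close>
definition loop_sum :: "(bool \<Rightarrow> bool \<Rightarrow> complex) \<Rightarrow> int set \<Rightarrow> (int \<Rightarrow> int) \<Rightarrow> complex" where
  "loop_sum \<beta> I p = (\<Sum>\<rho>\<in>sides I \<rightarrow>\<^sub>E UNIV.
     (\<Prod>k\<in>I. \<beta> (\<rho> (- k)) (\<rho> k)) * (\<Prod>k\<in>I. \<beta> (\<rho> (p (- k))) (\<rho> (p k))))"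

text \<open>
  The trivial character of the permutations for \<open>\<eta> = 1\<close>, and the signature for \<open>\<eta> = -1\<close>.
\<close>
definition sgn_pow :: "complex \<Rightarrow> (int \<Rightarrow> int) \<Rightarrow> complex" where
  "sgn_pow \<eta> p = (if evenperm p then 1 else \<eta>)"

lemma sgn_pow_compose:
  assumes "permutation p" "permutation q" "\<eta> \<in> {1, -1}"
  shows "sgn_pow \<eta> (p \<circ> q) = sgn_pow \<eta> p * sgn_pow \<eta> q"
  using assms(3) by (auto simp: sgn_pow_def evenperm_comp[OF assms(1,2)])

text \<open>
  Summing over the indices at \<open>\<plusminus> i\<close> when \<open>p i = i\<close>. If \<open>p (-i) = -i\<close> then \<open>{-i, i}\<close> is a double edge,
  that is a cycle of its own, and contributes \<open>2\<close>. Otherwise the second matching contains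
  \<open>{p (-i), i}\<close>; orthogonality of the form forces the index at \<open>-i\<close> to equal that at \<open>p (-i)\<close>, so
  that \<open>p (-i)\<close> takes over the partner of \<open>-i\<close>, which is what the transposition does.
\<close>
lemma loop_sum_contract:
  assumes b: "unit_form \<beta> \<eta>" and i: "i > 0" "i \<notin> J" and J: "finite J" "J \<subseteq> {0<..}"
    and p: "p permutes sides (insert i J)" and pi: "p i = i"
  shows "loop_sum \<beta> (insert i J) p =
    (if p (- i) = - i then 2 else 1) * loop_sum \<beta> J (Transposition.transpose (p (- i)) (- i) \<circ> p)"
proof -
  let ?c = "p (- i)" and ?p' = "Transposition.transpose (p (- i)) (- i) \<circ> p"
  let ?S = "sides J \<rightarrow>\<^sub>E (UNIV :: bool set)"
  have orth: "(\<Sum>y\<in>UNIV. \<beta> x y * \<beta> z y) = of_bool (x = z)" for x z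
    by (rule unit_formD[OF b])
  have ni: "- i \<noteq> i" "- i \<notin> sides J" "i \<notin> sides J" "i \<notin> insert (- i) (sides J)"
    using i J by (auto simp: sides_def)
  have pinj: "p x = p y \<longleftrightarrow> x = y" for x y using permutes_inj[OF p] by (auto simp: inj_eq)
  have kJ: "k \<noteq> i" "k \<noteq> - i" "- k \<noteq> i" if "k \<in> J" for k using that i J by auto
  have ci: "?c \<noteq> i" using pinj[of "- i" i] pi ni by auto
  define A where "A \<rho> = (\<Prod>k\<in>J. \<beta> (\<rho> (- k)) (\<rho> k))" for \<rho> :: "int \<Rightarrow> bool"
  define B where "B \<rho> = (\<Prod>k\<in>J. \<beta> (\<rho> (p (- k))) (\<rho> (p k)))" for \<rho> :: "int \<Rightarrow> bool"
  have A_upd: "A (\<rho>(- i := x, i := y)) = A \<rho>" for \<rho> x y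
    unfolding A_def using kJ by (intro prod.cong) auto
  have B_upd: "B (\<rho>(- i := x, i := y)) = B (\<rho>(- i := x))" for \<rho> x y
  proof -
    have "p k \<noteq> i" "p (- k) \<noteq> i" if "k \<in> J" for k
      using pinj pi kJ[OF that] by metis+
    then show ?thesis unfolding B_def by (intro prod.cong) auto
  qed
  have "loop_sum \<beta> (insert i J) p = (\<Sum>\<rho>\<in>?S. \<Sum>x\<in>UNIV. \<Sum>y\<in>UNIV.
      \<beta> x y * A \<rho> * (\<beta> ((\<rho>(- i := x, i := y)) ?c) y * B (\<rho>(- i := x))))"
    unfolding loop_sum_def sides_insert sum_PiE_insert[OF ni(4)] sum_PiE_insert[OF ni(2)]
  proof (intro sum.cong refl)
    fix \<rho> :: "int \<Rightarrow> bool" and x y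
    let ?\<rho> = "\<rho>(- i := x, i := y)"
    have "(\<Prod>k\<in>insert i J. \<beta> (?\<rho> (- k)) (?\<rho> k)) = \<beta> x y * A ?\<rho>"
      unfolding A_def prod.insert[OF J(1) i(2)] using ni by simp
    moreover have "(\<Prod>k\<in>insert i J. \<beta> (?\<rho> (p (- k))) (?\<rho> (p k))) = \<beta> (?\<rho> ?c) y * B ?\<rho>"
      unfolding B_def prod.insert[OF J(1) i(2)] using pi by simp
    ultimately show "(\<Prod>k\<in>insert i J. \<beta> (?\<rho> (- k)) (?\<rho> k)) *
        (\<Prod>k\<in>insert i J. \<beta> (?\<rho> (p (- k))) (?\<rho> (p k))) =
      \<beta> x y * A \<rho> * (\<beta> (?\<rho> ?c) y * B (\<rho>(- i := x)))"
      by (simp only: A_upd B_upd)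
  qed
  also have "\<dots> = (if ?c = - i then 2 else 1) * (\<Sum>\<rho>\<in>?S. A \<rho> *
      (\<Prod>k\<in>J. \<beta> (\<rho> (?p' (- k))) (\<rho> (?p' k))))"
    unfolding sum_distrib_left
  proof (intro sum.cong refl)
    fix \<rho> assume "\<rho> \<in> ?S"
    have notmi: "p k \<noteq> ?c" "p (- k) \<noteq> ?c" if "k \<in> J" for k
      using pinj kJ[OF that] by (metis, metis neg_equal_iff_equal)
    show "(\<Sum>x\<in>UNIV. \<Sum>y\<in>UNIV.
        \<beta> x y * A \<rho> * (\<beta> ((\<rho>(- i := x, i := y)) ?c) y * B (\<rho>(- i := x)))) =
      (if ?c = - i then 2 else 1) * (A \<rho> * (\<Prod>k\<in>J. \<beta> (\<rho> (?p' (- k))) (\<rho> (?p' k))))"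
    proof (cases "?c = - i")
      case True
      have B: "B (\<rho>(- i := x)) = (\<Prod>k\<in>J. \<beta> (\<rho> (?p' (- k))) (\<rho> (?p' k)))" for x
        unfolding B_def using notmi True by (intro prod.cong) auto
      have "(\<Sum>x\<in>UNIV. \<Sum>y\<in>UNIV.
          \<beta> x y * A \<rho> * (\<beta> ((\<rho>(- i := x, i := y)) ?c) y * B (\<rho>(- i := x)))) =
          (\<Sum>x\<in>UNIV. (\<Sum>y\<in>UNIV. \<beta> x y * \<beta> x y) * (A \<rho> * (\<Prod>k\<in>J. \<beta> (\<rho> (?p' (- k))) (\<rho> (?p' k)))))"
        using True ni B by (simp add: sum_distrib_left sum_distrib_right mult_ac)
      then show ?thesis using True by (simp add: orth)
    next
      case False
      have B: "B (\<rho>(- i := \<rho> ?c)) = (\<Prod>k\<in>J. \<beta> (\<rho> (?p' (- k))) (\<rho> (?p' k)))"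
      proof -
        have "(\<rho>(- i := \<rho> ?c)) z = \<rho> (Transposition.transpose ?c (- i) z)" if "z \<noteq> ?c" for z
          using that by (auto simp: Transposition.transpose_def)
        then show ?thesis unfolding B_def using notmi by (intro prod.cong) auto
      qed
      have "(\<Sum>x\<in>UNIV. \<Sum>y\<in>UNIV.
          \<beta> x y * A \<rho> * (\<beta> ((\<rho>(- i := x, i := y)) ?c) y * B (\<rho>(- i := x)))) =
          (\<Sum>x\<in>UNIV. (\<Sum>y\<in>UNIV. \<beta> x y * \<beta> (\<rho> ?c) y) * (A \<rho> * B (\<rho>(- i := x))))"
        using False ci ni by (simp add: sum_distrib_left sum_distrib_right mult_ac)
      also have "\<dots> = A \<rho> * B (\<rho>(- i := \<rho> ?c))"
        unfolding orth by (cases "\<rho> ?c") (simp_all add: UNIV_bool)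
      finally show ?thesis using False B by simp
    qed
  qed
  finally show ?thesis unfolding loop_sum_def A_def .
qed

text \<open>
  Reversing the order of one pair exchanges the arguments of one factor.
\<close>
lemma loop_sum_flip:
  assumes b: "unit_form \<beta> \<eta>" and I: "finite I" "I \<subseteq> {0<..}" and l: "l \<in> I"
  shows "loop_sum \<beta> I (p \<circ> Transposition.transpose l (- l)) = \<eta> * loop_sum \<beta> I p"
proof -
  let ?q = "p \<circ> Transposition.transpose l (- l)"
  have sw: "\<beta> y x = \<eta> * \<beta> x y" for x y by (rule unit_formD[OF b])
  have "(\<Prod>k\<in>I. \<beta> (\<rho> (?q (- k))) (\<rho> (?q k))) = \<eta> * (\<Prod>k\<in>I. \<beta> (\<rho> (p (- k))) (\<rho> (p k)))"
    for \<rho> :: "int \<Rightarrow> bool"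
  proof -
    have "(\<Prod>k\<in>I - {l}. \<beta> (\<rho> (?q (- k))) (\<rho> (?q k))) = (\<Prod>k\<in>I - {l}. \<beta> (\<rho> (p (- k))) (\<rho> (p k)))"
    proof (intro prod.cong refl)
      fix k assume "k \<in> I - {l}"
      then have "k > 0" "l > 0" "k \<noteq> l" using I l by auto
      then have "k \<noteq> l" "k \<noteq> - l" "- k \<noteq> l" "- k \<noteq> - l" by linarith+
      then show "\<beta> (\<rho> (?q (- k))) (\<rho> (?q k)) = \<beta> (\<rho> (p (- k))) (\<rho> (p k))"
        by (simp add: Transposition.transpose_def)
    qed
    then show ?thesis using l I sw[of "\<rho> (p l)" "\<rho> (p (- l))"] by (simp add: prod.remove)
  qed
  then show ?thesis unfolding loop_sum_def by (simp add: sum_distrib_left mult_ac)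
qed

text \<open>
  Exchanging two pairs of the second matching, with their orders, is an even permutation of the
  labels and only permutes the factors of the product.
\<close>
lemma loop_sum_swap:
  assumes I: "finite I" "I \<subseteq> {0<..}" and l: "l \<in> I" "i \<in> I"
  shows "loop_sum \<beta> I (p \<circ> (Transposition.transpose i l \<circ> Transposition.transpose (- i) (- l))) = loop_sum \<beta> I p"
proof -
  let ?h = "Transposition.transpose i l \<circ> Transposition.transpose (- i) (- l)"
  have h: "?h k = Transposition.transpose i l k" "?h (- k) = - Transposition.transpose i l k" if "k \<in> I" for k
  proof -
    have "k > 0" "i > 0" "l > 0" using that I l by auto
    then show "?h k = Transposition.transpose i l k" "?h (- k) = - Transposition.transpose i l k"
      by (auto simp: Transposition.transpose_def)
  qed
  have "(\<Prod>k\<in>I. \<beta> (\<rho> ((p \<circ> ?h) (- k))) (\<rho> ((p \<circ> ?h) k))) =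
      (\<Prod>k\<in>I. \<beta> (\<rho> (p (- k))) (\<rho> (p k)))" (is "?L = _") for \<rho> :: "int \<Rightarrow> bool"
  proof -
    have "?L = (\<Prod>k\<in>I. \<beta> (\<rho> (p (- Transposition.transpose i l k))) (\<rho> (p (Transposition.transpose i l k))))"
      using h by (intro prod.cong) (auto simp del: o_apply simp add: o_def)
    also have "\<dots> = (\<Prod>k\<in>I. \<beta> (\<rho> (p (- k))) (\<rho> (p k)))"
      using permutes_swap_id[OF l(2,1)]
      by (intro prod.reindex_bij_betw permutes_imp_bij)
    finally show ?thesis .
  qed
  then show ?thesis unfolding loop_sum_def by simp
qed

lemma finite_sides: "finite I \<Longrightarrow> finite (sides I)" by (simp add: sides_def)

text \<open>
  The exponent \<open>c\<close> depends on \<open>p\<close> only, not on the form. Flips and swaps of pairs reduce the claim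
  to a permutation that fixes some \<open>i\<close>, where \<open>loop_sum_contract\<close> applies. There a transposition
  costs a factor \<open>\<eta>\<close> in \<open>sgn_pow\<close>, which is made up by the smaller exponent of \<open>\<eta> ^ card I\<close>.
\<close>
lemma loop_sum_eq_sign_power:
  assumes "finite I" "I \<subseteq> {0<..}" "p permutes sides I"
  shows "\<exists>c::nat. \<forall>\<beta> \<eta>. unit_form \<beta> \<eta> \<longrightarrow>
    loop_sum \<beta> I p = sgn_pow \<eta> p * \<eta> ^ card I * (2 * \<eta>) ^ c"
  using assms
proof (induction I arbitrary: p rule: finite_induct)
  case empty
  then have "p = id" by (simp add: sides_def)
  then have "unit_form \<beta> \<eta> \<longrightarrow>
    loop_sum \<beta> {} p = sgn_pow \<eta> p * \<eta> ^ card {} * (2 * \<eta>) ^ 0" for \<beta> \<eta>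
    by (simp add: loop_sum_def sides_def sgn_pow_def)
  then show ?case by blast
next
  case (insert i J)
  let ?I = "insert i J"
  let ?P = "\<lambda>p c. \<forall>\<beta> \<eta>. unit_form \<beta> \<eta> \<longrightarrow>
    loop_sum \<beta> ?I p = sgn_pow \<eta> p * \<eta> ^ card ?I * (2 * \<eta>) ^ c"
  have i: "i > 0" "i \<notin> J" and J: "finite J" "J \<subseteq> {0<..}" and I: "finite ?I" "?I \<subseteq> {0<..}"
    using insert by auto
  have perm: "permutation q" if "q permutes sides ?I" for q
    using that finite_sides[OF I(1)] permutation_permutes by blast
  have si: "x \<in> sides ?I" "- x \<in> sides ?I" if "x \<in> ?I" for x using that by (auto simp: sides_def)
  have fixed: "\<exists>c. ?P p c" if p: "p permutes sides ?I" and pi: "p i = i" for p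
  proof -
    let ?t = "Transposition.transpose (p (- i)) (- i)"
    have pmi: "p (- i) \<in> sides ?I" using si[of i] permutes_in_image[OF p] by simp
    have t: "?t permutes sides ?I" using pmi si[of i] by (intro permutes_swap_id) auto
    have "p (- i) \<noteq> i" using pi permutes_inj[OF p] i by (metis injD neg_equal_zero less_irrefl)
    have p': "?t \<circ> p permutes sides J"
    proof (rule permutes_superset[OF permutes_compose[OF p t]])
      fix x assume "x \<in> sides ?I - sides J"
      then have "x = i \<or> x = - i" by (auto simp: sides_insert)
      then show "(?t \<circ> p) x = x"
        using pi \<open>p (- i) \<noteq> i\<close> i by (auto simp: Transposition.transpose_def)
    qed
    obtain c where c: "unit_form \<beta> \<eta> \<Longrightarrow>
        loop_sum \<beta> J (?t \<circ> p) = sgn_pow \<eta> (?t \<circ> p) * \<eta> ^ card J * (2 * \<eta>) ^ c" for \<beta> \<eta>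
      using insert.IH[OF J(2) p'] by blast
    \<comment> \<open>A closed double edge contributes \<open>2 = \<eta> * (2 * \<eta>)\<close>, that is, one further cycle.\<close>
    have "?P p (if p (- i) = - i then Suc c else c)"
    proof (intro allI impI)
      fix \<beta> \<eta> assume b: "unit_form \<beta> \<eta>"
      then have e: "\<eta> \<in> {1, -1}" by (rule unit_formD)
      have sg: "sgn_pow \<eta> (?t \<circ> p) = sgn_pow \<eta> ?t * sgn_pow \<eta> p"
        by (intro sgn_pow_compose perm p t e)
      show "loop_sum \<beta> ?I p =
          sgn_pow \<eta> p * \<eta> ^ card ?I * (2 * \<eta>) ^ (if p (- i) = - i then Suc c else c)"
        unfolding loop_sum_contract[OF b i J p pi] c[OF b] sg using i J e
        by (auto simp: sgn_pow_def evenperm_swap)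
    qed
    then show ?thesis by blast
  qed
  have pos: "\<exists>c. ?P p c" if p: "p permutes sides ?I" and l: "l \<in> ?I" "p l = i" for p l
  proof (cases "l = i")
    case True
    then show ?thesis using fixed p l by simp
  next
    case False
    \<comment> \<open>Moving the pair with index \<open>l\<close> to position \<open>i\<close> makes \<open>i\<close> a fixed point.\<close>
    let ?h = "Transposition.transpose i l \<circ> Transposition.transpose (- i) (- l)"
    have h: "Transposition.transpose i l permutes sides ?I" "Transposition.transpose (- i) (- l) permutes sides ?I"
      using si l by (auto intro!: permutes_swap_id)
    have ph: "p \<circ> ?h permutes sides ?I" by (intro permutes_compose p h)
    have "(p \<circ> ?h) i = i" using l False I by (auto simp: Transposition.transpose_def)
    then obtain c where c: "?P (p \<circ> ?h) c" using fixed[OF ph] by blast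
    have "?P p c"
    proof (intro allI impI)
      fix \<beta> \<eta> assume b: "unit_form \<beta> \<eta>"
      then have e: "\<eta> \<in> {1, -1}" by (rule unit_formD)
      have "sgn_pow \<eta> (p \<circ> ?h) = sgn_pow \<eta> p * (sgn_pow \<eta> (Transposition.transpose i l) * sgn_pow \<eta> (Transposition.transpose (- i) (- l)))"
        using perm h p e by (simp add: sgn_pow_compose permutation_compose)
      then have "sgn_pow \<eta> (p \<circ> ?h) = sgn_pow \<eta> p"
        using e False by (auto simp: sgn_pow_def evenperm_swap)
      then show "loop_sum \<beta> ?I p = sgn_pow \<eta> p * \<eta> ^ card ?I * (2 * \<eta>) ^ c"
        using c b loop_sum_swap[OF I l(1), of i \<beta> p] by auto
    qed
    then show ?thesis by blast
  qed
  have "i \<in> sides ?I" using si by simp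
  then obtain x where x: "x \<in> sides ?I" "p x = i"
    using permutes_image[OF insert.prems(2)] by (metis imageE)
  show ?case
  proof (cases "x \<in> ?I")
    case True
    then show ?thesis using pos insert.prems x by blast
  next
    case False
    then have l: "- x \<in> ?I" using x by (auto simp: sides_def)
    \<comment> \<open>Here \<open>i\<close> is the first element of its pair; a flip makes it the second.\<close>
    let ?h = "Transposition.transpose (- x) x"
    have h: "?h permutes sides ?I" using l x si by (auto intro!: permutes_swap_id)
    have ph: "p \<circ> ?h permutes sides ?I" by (intro permutes_compose insert.prems h)
    have "(p \<circ> ?h) (- x) = i" using x by simp
    then obtain c where c: "?P (p \<circ> ?h) c" using pos[OF ph l] by blast
    have "?P p c"
    proof (intro allI impI)
      fix \<beta> \<eta> assume b: "unit_form \<beta> \<eta>"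
      then have e: "\<eta> \<in> {1, -1}" by (rule unit_formD)
      have "- x \<noteq> x" using l I by auto
      then have s: "sgn_pow \<eta> (p \<circ> ?h) = \<eta> * sgn_pow \<eta> p"
        using perm h insert.prems(2) e by (simp add: sgn_pow_compose) (simp add: sgn_pow_def evenperm_swap)
      have "\<eta> * loop_sum \<beta> ?I p = loop_sum \<beta> ?I (p \<circ> ?h)"
        using loop_sum_flip[OF b I l, of p] by simp
      also have "\<dots> = \<eta> * (sgn_pow \<eta> p * \<eta> ^ card ?I * (2 * \<eta>) ^ c)"
        using c b s by simp
      finally show "loop_sum \<beta> ?I p = sgn_pow \<eta> p * \<eta> ^ card ?I * (2 * \<eta>) ^ c"
        using e by auto
    qed
    then show ?thesis by blast
  qed
qed

section \<open>Cycles of two pairings\<close>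

text \<open>
  A cycle in the sense of \<open>cycles\<close> is the set of edges inside a connected component, which turns
  statements about cycles into statements about components.
\<close>
definition component :: "'a set set \<Rightarrow> 'a set set \<Rightarrow> 'a \<Rightarrow> 'a set" where
  "component P Q x = {y. (x, y) \<in> {(a, b). {a, b} \<in> P \<union> Q}\<^sup>*}"

definition cycle_at :: "'a set set \<Rightarrow> 'a set set \<Rightarrow> 'a \<Rightarrow> 'a cycle" where
  "cycle_at P Q x = ({B \<in> P. B \<subseteq> component P Q x}, {B \<in> Q. B \<subseteq> component P Q x})"

lemma component_refl: "x \<in> component P Q x"
  by (simp add: component_def)

lemma component_step:
  "y \<in> component P Q x \<Longrightarrow> {y, z} \<in> P \<union> Q \<Longrightarrow> z \<in> component P Q x"
  unfolding component_def by (auto intro: rtrancl_into_rtrancl)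

lemma component_eq:
  assumes "y \<in> component P Q x" shows "component P Q y = component P Q x"
proof -
  have "sym {(a, b). {a, b} \<in> P \<union> Q}" by (auto simp: sym_def insert_commute)
  then have "sym ({(a, b). {a, b} \<in> P \<union> Q}\<^sup>*)" by (rule sym_rtrancl)
  then show ?thesis
    using assms unfolding component_def by (auto dest: symD intro: rtrancl_trans)
qed

locale two_pair_partitions =
  fixes A :: "'a set" and P Q :: "'a set set"
  assumes fin: "finite A" and P: "pair_partition A P" and Q: "pair_partition A Q"
begin

lemma component_subset:
  assumes "x \<in> A" shows "component P Q x \<subseteq> A"
proof
  fix y assume "y \<in> component P Q x"
  then have "(x, y) \<in> {(a, b). {a, b} \<in> P \<union> Q}\<^sup>*" by (simp add: component_def)
  then show "y \<in> A"
    by (induction rule: rtrancl_induct)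
      (use assms P Q in \<open>auto simp: pair_partition_def partition_on_def\<close>)
qed

lemma Union_cycle_at:
  assumes x: "x \<in> A"
  shows "\<Union>(fst (cycle_at P Q x)) = component P Q x" "\<Union>(snd (cycle_at P Q x)) = component P Q x"
proof -
  have "y \<in> \<Union>{B \<in> R. B \<subseteq> component P Q x}"
    if y: "y \<in> component P Q x" and R: "R = P \<or> R = Q" for y R
  proof -
    have "y \<in> A" "pair_partition A R" using component_subset[OF x] y P Q R by auto
    then obtain z where z: "{y, z} \<in> R" by (metis pair_partition_partner)
    have "z \<in> component P Q x" using component_step[OF y] z R by auto
    then show ?thesis using z y by blast
  qed
  then show "\<Union>(fst (cycle_at P Q x)) = component P Q x" "\<Union>(snd (cycle_at P Q x)) = component P Q x"
    unfolding cycle_at_def by auto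
qed

lemma cycle_at_in_cycles:
  assumes x: "x \<in> A" shows "cycle_at P Q x \<in> cycles P Q"
proof -
  let ?C = "component P Q x"
  let ?D = "{B \<in> P. B \<subseteq> ?C}" and ?E = "{B \<in> Q. B \<subseteq> ?C}"
  have U: "\<Union>?D = ?C" "\<Union>?E = ?C"
    using Union_cycle_at[OF x] by (auto simp: cycle_at_def)
  have "(y, z) \<in> {(a, b). {a, b} \<in> ?D \<union> ?E}\<^sup>*" if "y \<in> ?C" "z \<in> ?C" for y z
  proof -
    have "(y, z) \<in> {(a, b). {a, b} \<in> P \<union> Q}\<^sup>*"
      using that component_eq[OF that(1)] by (auto simp: component_def)
    then have "z \<in> ?C \<and> (y, z) \<in> {(a, b). {a, b} \<in> ?D \<union> ?E}\<^sup>*"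
    proof (induction rule: rtrancl_induct)
      case base
      then show ?case using that by simp
    next
      case (step a b)
      then have "b \<in> ?C" using component_step[of a P Q x b] by auto
      then have "(a, b) \<in> {(a, b). {a, b} \<in> ?D \<union> ?E}" using step by auto
      then show ?case using step \<open>b \<in> ?C\<close> by (metis (no_types, lifting) rtrancl_into_rtrancl)
    qed
    then show ?thesis by blast
  qed
  then show ?thesis
    unfolding cycles_def cycle_at_def using U component_refl[of x P Q] by auto
qed

text \<open>
  The equality of vertex sets in the definition of a cycle means that no edge leaves it, since at
  each vertex there is only one edge of either kind; hence a cycle is a whole component.
\<close>
lemma cycle_eq_cycle_at:
  assumes c: "(D, E) \<in> cycles P Q" and x: "x \<in> \<Union>D"
  shows "(D, E) = cycle_at P Q x"
proof -
  have DE: "D \<subseteq> P" "E \<subseteq> Q" "\<Union>D = \<Union>E"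
    and con: "\<And>y z. y \<in> \<Union>D \<Longrightarrow> z \<in> \<Union>D \<Longrightarrow> (y, z) \<in> {(a, b). {a, b} \<in> D \<union> E}\<^sup>*"
    using c unfolding cycles_def by blast+
  have mem: "B \<in> D" if "B \<in> P" "y \<in> B" "y \<in> \<Union>D" for B y
  proof -
    from that obtain B' where "B' \<in> D" "y \<in> B'" by blast
    then show ?thesis using pair_partition_unique[OF P, of B B' y] that DE by auto
  qed
  have mem': "B \<in> E" if "B \<in> Q" "y \<in> B" "y \<in> \<Union>D" for B y
  proof -
    from that DE obtain B' where "B' \<in> E" "y \<in> B'" by blast
    then show ?thesis using pair_partition_unique[OF Q, of B B' y] that DE by auto
  qed
  have "component P Q x \<subseteq> \<Union>D"
  proof
    fix y assume "y \<in> component P Q x"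
    then have "(x, y) \<in> {(a, b). {a, b} \<in> P \<union> Q}\<^sup>*" by (simp add: component_def)
    then show "y \<in> \<Union>D"
    proof (induction rule: rtrancl_induct)
      case base show ?case by (rule x)
    next
      case (step a b)
      then consider "{a, b} \<in> P" | "{a, b} \<in> Q" by auto
      then show ?case
      proof cases
        case 1 then have "{a, b} \<in> D" using mem step by blast
        then show ?thesis by blast
      next
        case 2 then have "{a, b} \<in> E" using mem' step by blast
        then show ?thesis using DE by blast
      qed
    qed
  qed
  moreover have "\<Union>D \<subseteq> component P Q x"
  proof
    fix y assume "y \<in> \<Union>D"
    then have "(x, y) \<in> {(a, b). {a, b} \<in> D \<union> E}\<^sup>*" using con x by blast
    moreover have "{(a, b). {a, b} \<in> D \<union> E} \<subseteq> {(a, b). {a, b} \<in> P \<union> Q}" using DE by auto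
    ultimately show "y \<in> component P Q x"
      unfolding component_def using rtrancl_mono by blast
  qed
  ultimately have C: "component P Q x = \<Union>D" by simp
  have ne: "B \<noteq> {}" if "B \<in> P \<union> Q" for B
    using that P Q by (auto simp: pair_partition_def)
  have "{B \<in> P. B \<subseteq> \<Union>D} = D"
  proof (intro equalityI subsetI)
    fix B assume B: "B \<in> {B \<in> P. B \<subseteq> \<Union>D}"
    then obtain y where "y \<in> B" using ne by fastforce
    then show "B \<in> D" using mem B by blast
  qed (use DE in auto)
  moreover have "{B \<in> Q. B \<subseteq> \<Union>D} = E"
  proof (intro equalityI subsetI)
    fix B assume B: "B \<in> {B \<in> Q. B \<subseteq> \<Union>D}"
    then obtain y where "y \<in> B" using ne by fastforce
    then show "B \<in> E" using mem' B by blast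
  qed (use DE in auto)
  ultimately show ?thesis by (simp add: cycle_at_def C)
qed

lemma cycles_eq_image: "cycles P Q = cycle_at P Q ` A"
proof (intro equalityI subsetI)
  fix c assume c: "c \<in> cycles P Q"
  obtain D E where DE: "c = (D, E)" by (cases c)
  then obtain x where x: "x \<in> \<Union>D" using c by (auto simp: cycles_def)
  have "D \<subseteq> P" using c DE by (auto simp: cycles_def)
  then have "x \<in> A" using x P by (auto simp: pair_partition_def partition_on_def)
  then show "c \<in> cycle_at P Q ` A" using cycle_eq_cycle_at[of D E x] c DE x by auto
qed (auto intro: cycle_at_in_cycles)

lemma finite_cycles: "finite (cycles P Q)"
  by (simp add: cycles_eq_image fin)

lemma cycle_at_eq_iff:
  assumes "x \<in> A" "y \<in> A"
  shows "cycle_at P Q x = cycle_at P Q y \<longleftrightarrow> y \<in> component P Q x"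
proof
  assume "cycle_at P Q x = cycle_at P Q y"
  then have "component P Q x = component P Q y" using Union_cycle_at(1) assms by metis
  then show "y \<in> component P Q x" using component_refl by metis
next
  assume "y \<in> component P Q x"
  then show "cycle_at P Q x = cycle_at P Q y" by (simp add: cycle_at_def component_eq)
qed

lemma Union_snd_cycles: "\<Union>(snd ` cycles P Q) = Q"
proof (intro equalityI subsetI)
  fix B assume "B \<in> \<Union>(snd ` cycles P Q)"
  then show "B \<in> Q" by (auto simp: cycles_def)
next
  fix B assume B: "B \<in> Q"
  then obtain a b where ab: "B = {a, b}" "a \<in> A" by (metis pair_partition_pair Q)
  have "b \<in> component P Q a" using component_step[OF component_refl, of a b P Q] B ab by simp
  then have "B \<in> snd (cycle_at P Q a)" using B ab by (simp add: cycle_at_def component_refl)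
  then show "B \<in> \<Union>(snd ` cycles P Q)" using cycle_at_in_cycles[OF ab(2)] by blast
qed

lemma ex1_cycle_of_pair:
  assumes B: "B \<in> P" shows "\<exists>!c. c \<in> cycles P Q \<and> B \<in> fst c"
proof -
  obtain a b where ab: "B = {a, b}" "a \<in> A" using B by (metis pair_partition_pair P)
  have "b \<in> component P Q a" using component_step[OF component_refl, of a b P Q] B ab by simp
  then have "B \<in> fst (cycle_at P Q a)" using B ab by (simp add: cycle_at_def component_refl)
  moreover have "c = cycle_at P Q a" if "c \<in> cycles P Q" "B \<in> fst c" for c
    using that cycle_eq_cycle_at[of "fst c" "snd c" a] ab by auto
  ultimately show ?thesis using cycle_at_in_cycles[OF ab(2)] by blast
qed

text \<open>
  A function that is constant along all edges is an arbitrary choice of a value on each cycle. This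
  gives access to the number of cycles without tracing them.
\<close>
lemma card_invariant_functions:
  "card {f \<in> A \<rightarrow>\<^sub>E (UNIV :: bool set). \<forall>a b. {a, b} \<in> P \<union> Q \<longrightarrow> f a = f b} = 2 ^ card (cycles P Q)"
    (is "card ?F = _")
proof -
  have inA: "a \<in> A" "b \<in> A" if "{a, b} \<in> P \<union> Q" for a b
    using that P Q by (auto simp: pair_partition_def partition_on_def)
  have const: "f y = f x" if f: "f \<in> ?F" and y: "y \<in> component P Q x" for f x y
  proof -
    have "(x, y) \<in> {(a, b). {a, b} \<in> P \<union> Q}\<^sup>*" using y by (simp add: component_def)
    then show ?thesis by (induction rule: rtrancl_induct) (use f in auto)
  qed
  let ?\<Phi> = "\<lambda>g. restrict (g \<circ> cycle_at P Q) A"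
  have "bij_betw ?\<Phi> (cycles P Q \<rightarrow>\<^sub>E (UNIV :: bool set)) ?F"
    unfolding bij_betw_def
  proof (intro conjI equalityI subsetI)
    show "inj_on ?\<Phi> (cycles P Q \<rightarrow>\<^sub>E UNIV)"
    proof (intro inj_onI PiE_ext[of _ "cycles P Q" "\<lambda>_. UNIV"])
      fix g h c assume e: "?\<Phi> g = ?\<Phi> h" and "c \<in> cycles P Q"
      then obtain a where "a \<in> A" "c = cycle_at P Q a" by (auto simp: cycles_eq_image)
      then show "g c = h c" using fun_cong[OF e, of a] by simp
    qed auto
  next
    fix f assume "f \<in> ?\<Phi> ` (cycles P Q \<rightarrow>\<^sub>E (UNIV :: bool set))"
    then obtain g where g: "f = ?\<Phi> g" by blast
    have "f a = f b" if ab: "{a, b} \<in> P \<union> Q" for a b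
    proof -
      have "b \<in> component P Q a" using component_step[OF component_refl ab] .
      then show ?thesis using inA[OF ab] cycle_at_eq_iff[of a b] g by simp
    qed
    then show "f \<in> ?F" using g by auto
  next
    fix f assume f: "f \<in> ?F"
    define g where "g = restrict (\<lambda>c. f (SOME a. a \<in> A \<and> cycle_at P Q a = c)) (cycles P Q)"
    have "f = ?\<Phi> g"
    proof
      fix x show "f x = ?\<Phi> g x"
      proof (cases "x \<in> A")
        case True
        let ?y = "SOME a. a \<in> A \<and> cycle_at P Q a = cycle_at P Q x"
        have "?y \<in> A \<and> cycle_at P Q ?y = cycle_at P Q x"
          by (rule someI[of _ x]) (use True in simp)
        then have "?y \<in> component P Q x" using cycle_at_eq_iff[of x ?y] True by auto
        then have "f ?y = f x" by (rule const[OF f])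
        then show ?thesis using True cycle_at_in_cycles by (simp add: g_def)
      next
        case False
        then show ?thesis using f by (auto simp: PiE_def extensional_def)
      qed
    qed
    moreover have "g \<in> cycles P Q \<rightarrow>\<^sub>E UNIV" by (simp add: g_def)
    ultimately show "f \<in> ?\<Phi> ` (cycles P Q \<rightarrow>\<^sub>E UNIV)" by blast
  qed
  then have "card ?F = card (cycles P Q \<rightarrow>\<^sub>E (UNIV :: bool set))"
    by (simp add: bij_betw_same_card)
  then show ?thesis using finite_cycles by (simp add: card_PiE)
qed

end

section \<open>Signed contractions and the number of cycles\<close>

lemma uminus_notin_positive:
  fixes I :: "int set"
  assumes "I \<subseteq> {0<..}" "k \<in> I" shows "- k \<notin> I"
proof
  assume "- k \<in> I"
  then have "0 < - k" "0 < k" using assms by blast+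
  then show False by simp
qed

lemma sum_bool: "(\<Sum>x\<in>UNIV. f x) = f False + f True"
  by (simp add: UNIV_bool add.commute)

lemma sum_bool_pick:
  fixes g :: "bool \<Rightarrow> 'a :: comm_semiring_1"
  shows "(\<Sum>x\<in>UNIV. of_bool (c = x) * g x) = g c" "(\<Sum>x\<in>UNIV. of_bool (x = c) * g x) = g c"
  by (cases c; simp add: sum_bool)+

lemma sum_PiE_sides:
  assumes "I \<subseteq> {0<..}"
  shows "(\<Sum>p\<in>I \<rightarrow>\<^sub>E K. \<Sum>u\<in>I \<rightarrow>\<^sub>E K. F (\<lambda>a\<in>sides I. if a \<in> I then p a else u (- a))) =
    (\<Sum>c\<in>sides I \<rightarrow>\<^sub>E K. F c)"
proof -
  have d: "- k \<notin> I" if "k \<in> I" for k using uminus_notin_positive[OF assms that] .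
  have "(\<Sum>(p, u)\<in>(I \<rightarrow>\<^sub>E K) \<times> (I \<rightarrow>\<^sub>E K). F (\<lambda>a\<in>sides I. if a \<in> I then p a else u (- a))) =
      (\<Sum>c\<in>sides I \<rightarrow>\<^sub>E K. F c)"
    by (rule sum.reindex_bij_witness[where i = "\<lambda>c. (restrict c I, \<lambda>k\<in>I. c (- k))" and
          j = "\<lambda>(p, u). \<lambda>a\<in>sides I. if a \<in> I then p a else u (- a)"])
      (use d in \<open>auto simp: fun_eq_iff PiE_def extensional_def Pi_def restrict_def sides_def\<close>)
  then show ?thesis by (simp add: sum.cartesian_product)
qed

lemma prod_sum_sides:
  fixes f :: "int \<Rightarrow> 'b \<Rightarrow> 'b \<Rightarrow> 'c :: comm_semiring_1"
  assumes I: "finite I" "I \<subseteq> {0<..}" and K: "finite K"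
  shows "(\<Prod>k\<in>I. \<Sum>x\<in>K. \<Sum>y\<in>K. f k x y) = (\<Sum>c\<in>sides I \<rightarrow>\<^sub>E K. \<Prod>k\<in>I. f k (c (- k)) (c k))"
proof -
  have d: "- k \<notin> I" if "k \<in> I" for k using uminus_notin_positive[OF I(2) that] .
  have "(\<Prod>k\<in>I. \<Sum>x\<in>K. \<Sum>y\<in>K. f k x y) =
      (\<Sum>u\<in>I \<rightarrow>\<^sub>E K. \<Sum>p\<in>I \<rightarrow>\<^sub>E K. \<Prod>k\<in>I. f k (u k) (p k))"
    using I K by (simp add: prod_sum_PiE)
  also have "\<dots> = (\<Sum>p\<in>I \<rightarrow>\<^sub>E K. \<Sum>u\<in>I \<rightarrow>\<^sub>E K. \<Prod>k\<in>I. f k (u k) (p k))"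
    by (rule sum.swap)
  also have "\<dots> = (\<Sum>c\<in>sides I \<rightarrow>\<^sub>E K. \<Prod>k\<in>I. f k (c (- k)) (c k))"
    unfolding sum_PiE_sides[OF I(2), symmetric]
    using d by (intro sum.cong refl prod.cong) (auto simp: sides_def)
  finally show ?thesis .
qed

lemma prod_sides:
  assumes "finite I" "I \<subseteq> {0<..}"
  shows "(\<Prod>a\<in>sides I. f a) = (\<Prod>k\<in>I. f (- k) * f k)"
proof -
  have "(\<Prod>a\<in>sides I. f a) = (\<Prod>a\<in>I. f a) * (\<Prod>a\<in>uminus ` I. f a)"
    unfolding sides_def using assms uminus_notin_positive[OF assms(2)] by (intro prod.union_disjoint) auto
  also have "(\<Prod>a\<in>uminus ` I. f a) = (\<Prod>k\<in>I. f (- k))"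
    by (subst prod.reindex) (auto simp: inj_on_def)
  finally show ?thesis by (simp add: prod.distrib mult.commute)
qed

definition image_pairs :: "int set \<Rightarrow> (int \<Rightarrow> int) \<Rightarrow> int set set" where
  "image_pairs I p = (\<lambda>k. {p (- k), p k}) ` I"

lemma pair_partition_image_pairs:
  assumes I: "I \<subseteq> {0<..}" and p: "p permutes sides I"
  shows "pair_partition (sides I) (image_pairs I p)"
proof -
  have inj: "p x = p y \<longleftrightarrow> x = y" for x y using permutes_inj[OF p] by (auto simp: inj_eq)
  have pos: "k > 0" if "k \<in> I" for k using that I by auto
  have "\<Union>(image_pairs I p) = p ` sides I"
    by (auto simp: image_pairs_def sides_def)
  moreover have "disjoint (image_pairs I p)"
    unfolding image_pairs_def disjoint_def using pos by (auto simp: inj)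
  moreover have "card B = 2" if B: "B \<in> image_pairs I p" for B
  proof -
    obtain k where "k \<in> I" "B = {p (- k), p k}" using B by (auto simp: image_pairs_def)
    then show ?thesis using pos[of k] by (auto simp: inj card_2_iff)
  qed
  ultimately show ?thesis
    using permutes_image[OF p] unfolding pair_partition_def partition_on_def
    by (auto simp: image_pairs_def)
qed

text \<open>
  A pairing of \<open>I \<union> -I\<close> has as many pairs as \<open>I\<close> has elements. Enumerating the pairs by \<open>I\<close> and
  ordering each of them gives the permutation.
\<close>
lemma pair_partition_obtain_permutation:
  assumes I: "finite I" "I \<subseteq> {0<..}" and g: "pair_partition (sides I) \<gamma>"
  obtains p where "p permutes sides I" "\<gamma> = image_pairs I p"
proof -
  have fin: "finite (sides I)" using I by (simp add: finite_sides)
  have U: "\<Union>\<gamma> = sides I" and c2: "\<And>B. B \<in> \<gamma> \<Longrightarrow> card B = 2"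
    using g by (auto simp: pair_partition_def partition_on_def)
  have fg: "finite \<gamma>" using U fin by (metis finite_UnionD)
  have "card (sides I) = card I + card (uminus ` I)"
    unfolding sides_def using I uminus_notin_positive[OF I(2)] by (intro card_Un_disjoint) auto
  then have "card (sides I) = 2 * card I" by (simp add: card_image)
  moreover have "2 * card \<gamma> = card (\<Union>\<gamma>)"
    using g U fin fg c2 by (intro card_partition) (auto simp: pair_partition_def partition_on_def disjoint_def)
  ultimately have "card I = card \<gamma>" using U by simp
  then obtain h where h: "bij_betw h I \<gamma>" using I fg finite_same_card_bij by blast
  have "\<forall>B\<in>\<gamma>. \<exists>u w. B = {u, w}" using c2 by (metis card_2_iff)
  then obtain u w where uw: "\<And>B. B \<in> \<gamma> \<Longrightarrow> B = {u B, w B}" by metis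
  define p where "p a = (if a \<in> I then w (h a) else if - a \<in> I then u (h (- a)) else a)" for a
  have neg: "- k \<notin> I" if "k \<in> I" for k using uminus_notin_positive[OF I(2) that] .
  have pk: "p k = w (h k)" "p (- k) = u (h k)" if "k \<in> I" for k
    using that neg by (auto simp: p_def)
  have ip: "image_pairs I p = \<gamma>"
  proof -
    have "image_pairs I p = h ` I" unfolding image_pairs_def
    proof (intro image_cong refl)
      fix k assume "k \<in> I"
      then show "{p (- k), p k} = h k" using pk uw[of "h k"] bij_betwE[OF h] by auto
    qed
    then show ?thesis using h by (simp add: bij_betw_def)
  qed
  have "p ` sides I = \<Union>(image_pairs I p)" by (auto simp: image_pairs_def sides_def)
  then have im: "p ` sides I = sides I" using ip U by simp
  have "p permutes sides I"
  proof (rule bij_imp_permutes)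
    show "bij_betw p (sides I) (sides I)"
      using im eq_card_imp_inj_on[OF fin, of p] by (simp add: bij_betw_def)
    show "p x = x" if "x \<notin> sides I" for x
      using that by (auto simp: p_def sides_def image_iff)
  qed
  then show ?thesis using that ip by blast
qed

text \<open>
  The contraction along two matchings, both given as images of the pairs \<open>{-k, k}\<close>.
\<close>
definition overlap :: "(bool \<Rightarrow> bool \<Rightarrow> complex) \<Rightarrow> int set \<Rightarrow> (int \<Rightarrow> int) \<Rightarrow> (int \<Rightarrow> int) \<Rightarrow> complex" where
  "overlap \<beta> I p q = (\<Sum>\<rho>\<in>sides I \<rightarrow>\<^sub>E UNIV.
     (\<Prod>k\<in>I. \<beta> (\<rho> (p (- k))) (\<rho> (p k))) * (\<Prod>k\<in>I. \<beta> (\<rho> (q (- k))) (\<rho> (q k))))"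

lemma overlap_eq_loop_sum:
  assumes p: "p permutes sides I" and q: "q permutes sides I"
  shows "overlap \<beta> I p q = loop_sum \<beta> I (inv p \<circ> q)"
proof -
  note ip = permutes_inv[OF p]
  let ?r = "\<lambda>\<rho>. restrict (\<rho> \<circ> p) (sides I)"
  have s: "k \<in> sides I" "- k \<in> sides I" if "k \<in> I" for k using that by (auto simp: sides_def)
  have "loop_sum \<beta> I (inv p \<circ> q) = (\<Sum>\<rho>\<in>sides I \<rightarrow>\<^sub>E UNIV. (\<Prod>k\<in>I. \<beta> (?r \<rho> (- k)) (?r \<rho> k)) *
      (\<Prod>k\<in>I. \<beta> (?r \<rho> ((inv p \<circ> q) (- k))) (?r \<rho> ((inv p \<circ> q) k))))"
    unfolding loop_sum_def by (rule sum_PiE_permute[OF p, symmetric])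
  also have "\<dots> = overlap \<beta> I p q"
    unfolding overlap_def
    by (intro sum.cong refl arg_cong2[where f = "(*)"] prod.cong)
      (simp_all add: s permutes_inverses[OF p] permutes_in_image[OF ip] permutes_in_image[OF q])
  finally show ?thesis by simp
qed

text \<open>
  For the form of equality only the functions that are constant along the edges contribute.
\<close>
lemma overlap_same:
  assumes I: "finite I" "I \<subseteq> {0<..}" and p: "p permutes sides I" and q: "q permutes sides I"
  shows "overlap same I p q = 2 ^ card (cycles (image_pairs I p) (image_pairs I q))"
proof -
  interpret two_pair_partitions "sides I" "image_pairs I p" "image_pairs I q"
    using finite_sides[OF I(1)] pair_partition_image_pairs[OF I(2)] p q by unfold_locales auto
  let ?inv = "\<lambda>\<rho>. \<forall>a b. {a, b} \<in> image_pairs I p \<union> image_pairs I q \<longrightarrow> \<rho> a = \<rho> b"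
  have pr: "(\<Prod>k\<in>I. same (f k) (g k)) = of_bool (\<forall>k\<in>I. f k = g k)" for f g
    using I(1) by (induction I rule: finite_induct) (auto simp: same_def)
  have "overlap same I p q = (\<Sum>\<rho>\<in>sides I \<rightarrow>\<^sub>E (UNIV :: bool set). of_bool (?inv \<rho>))"
  proof -
    have inv: "?inv \<rho> \<longleftrightarrow> (\<forall>k\<in>I. \<rho> (p (- k)) = \<rho> (p k)) \<and> (\<forall>k\<in>I. \<rho> (q (- k)) = \<rho> (q k))" for \<rho> :: "int \<Rightarrow> bool"
      by (auto simp: image_pairs_def doubleton_eq_iff)
    show ?thesis unfolding overlap_def pr by (intro sum.cong refl) (subst inv, rule of_bool_conj[symmetric])
  qed
  also have "\<dots> = of_nat (card {\<rho> \<in> sides I \<rightarrow>\<^sub>E (UNIV :: bool set). ?inv \<rho>})"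
    using fin by (simp add: finite_PiE Int_def sum.If_cases of_bool_def)
  finally show ?thesis by (simp only: card_invariant_functions of_nat_power of_nat_numeral)
qed

text \<open>
  Evaluating \<open>loop_sum_eq_sign_power\<close> for both forms: the form of equality identifies the exponent
  as the number of cycles, the form \<open>\<epsilon>\<close> then gives the signed value.
\<close>
lemma overlap_eps:
  assumes I: "finite I" "I \<subseteq> {0<..}" and p: "p permutes sides I" and q: "q permutes sides I"
  shows "overlap eps I p q = sgn_pow (-1) p * sgn_pow (-1) q * (-1) ^ card I *
    (-2) ^ card (cycles (image_pairs I p) (image_pairs I q))"
proof -
  have r: "inv p \<circ> q permutes sides I" by (intro permutes_compose permutes_inv p q)
  obtain c where c: "\<And>\<beta> \<eta>. unit_form \<beta> \<eta> \<Longrightarrow>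
      loop_sum \<beta> I (inv p \<circ> q) = sgn_pow \<eta> (inv p \<circ> q) * \<eta> ^ card I * (2 * \<eta>) ^ c"
    using loop_sum_eq_sign_power[OF I r] by blast
  have "overlap same I p q = 2 ^ c"
    using c[OF unit_form_same] overlap_eq_loop_sum[OF p q, of same] by (simp add: sgn_pow_def)
  then have "(of_nat (2 ^ c) :: complex) = of_nat (2 ^ card (cycles (image_pairs I p) (image_pairs I q)))"
    using overlap_same[OF I p q] by simp
  then have "c = card (cycles (image_pairs I p) (image_pairs I q))"
    unfolding of_nat_eq_iff by simp
  moreover have "permutation p" "permutation q"
    using p q finite_sides[OF I(1)] permutation_permutes by blast+
  then have "sgn_pow (-1) (inv p \<circ> q) = sgn_pow (-1) p * sgn_pow (-1) q"
    by (subst sgn_pow_compose) (auto simp: permutation_inverse sgn_pow_def evenperm_inv)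
  ultimately show ?thesis
    using c[OF unit_form_eps] overlap_eq_loop_sum[OF p q, of eps] by simp
qed

section \<open>Quaternions as matrices\<close>

text \<open>
  The matrix of \<open>\<alpha> + \<beta> j\<close> with complex \<open>\<alpha> = x\<^sub>0 + i x\<^sub>1\<close> and \<open>\<beta> = x\<^sub>2 + i x\<^sub>3\<close>: its rows are
  \<open>(\<alpha>, \<beta>)\<close> and \<open>(-cnj \<beta>, cnj \<alpha>)\<close>, with \<open>False\<close> as the first index.
\<close>
definition qmat :: "quat \<Rightarrow> bool \<Rightarrow> bool \<Rightarrow> complex" where
  "qmat q x y =
     (if x then if y then Complex (qre q) (- qi q) else Complex (- qj q) (qk q)
      else if y then Complex (qj q) (qk q) else Complex (qre q) (qi q))"

lemma qmat_mult: "qmat (p * q) x y = (\<Sum>z\<in>UNIV. qmat p x z * qmat q z y)"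
  by (simp add: qmat_def UNIV_bool times_quat_def complex_eq_iff algebra_simps)

text \<open>
  The matrix of the conjugate is the adjoint, which for these matrices is the adjugate. In this form
  no complex conjugate of an entry occurs, so that all entries remain linear in the quaternion.
\<close>
lemma qmat_qcnj: "qmat (qcnj q) x y = (\<Sum>u\<in>UNIV. \<Sum>v\<in>UNIV. eps x u * eps y v * qmat q v u)"
  by (simp add: qmat_def UNIV_bool qcnj_def complex_eq_iff eps_def)

lemma qre_eq_half_trace: "complex_of_real (qre q) = (\<Sum>x\<in>UNIV. qmat q x x) / 2"
  by (simp add: qmat_def UNIV_bool complex_eq_iff)

definition unit_mat :: "(quat \<Rightarrow> real) \<Rightarrow> bool \<Rightarrow> bool \<Rightarrow> complex" where
  "unit_mat d = qmat (Quat (of_bool (d = qre)) (of_bool (d = qi)) (of_bool (d = qj)) (of_bool (d = qk)))"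

lemma qmat_coords: "qmat q x y = (\<Sum>d\<in>coords. unit_mat d x y * of_real (d q))"
proof -
  have "qre \<noteq> qi" "qre \<noteq> qj" "qre \<noteq> qk" "qi \<noteq> qj" "qi \<noteq> qk" "qj \<noteq> qk"
    "qi \<noteq> qre" "qj \<noteq> qre" "qk \<noteq> qre" "qj \<noteq> qi" "qk \<noteq> qi" "qk \<noteq> qj"
    using coords_distinct by auto
  then show ?thesis
    by (simp add: sum_coords unit_mat_def qmat_def complex_eq_iff)
qed

text \<open>
  The sum over the four units is the covariance of the entries of the matrix of a standard
  quaternion Gaussian variable; it separates into a factor for the rows and one for the columns.
\<close>
lemma unit_mat_covariance:
  "(\<Sum>d\<in>coords. unit_mat d x y * unit_mat d x' y') = 2 * (eps x x' * eps y y')"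
proof -
  have "qre \<noteq> qi" "qre \<noteq> qj" "qre \<noteq> qk" "qi \<noteq> qj" "qi \<noteq> qk" "qj \<noteq> qk"
    "qi \<noteq> qre" "qj \<noteq> qre" "qk \<noteq> qre" "qj \<noteq> qi" "qk \<noteq> qi" "qk \<noteq> qj"
    using coords_distinct by auto
  then show ?thesis
    by (simp add: sum_coords unit_mat_def qmat_def complex_eq_iff eps_def)
qed

text \<open>
  The index \<open>p k\<close> is the column index of the \<open>k\<close>-th factor and the row index of the next one.
\<close>
lemma qmat_prod_list:
  assumes "a \<le> b"
  shows "qmat (prod_list (map f [a..b])) x y = (\<Sum>p\<in>{a..b} \<rightarrow>\<^sub>E UNIV. of_bool (p b = y) *
    (\<Prod>k\<in>{a..b}. qmat (f k) (if k = a then x else p (k - 1)) (p k)))"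
  using assms
proof (induction b arbitrary: y rule: int_ge_induct)
  case base
  have "{a..a} = insert a {}" by auto
  then show ?case
    by (simp only: sum_PiE_insert[of a "{}"] empty_iff not_False_eq_True)
      (simp add: UNIV_bool)
next
  case (step b)
  let ?G = "\<lambda>p. \<Prod>k\<in>{a..b}. qmat (f k) (if k = a then x else p (k - 1)) (p k)"
  have up: "{a..b + 1} = insert (b + 1) {a..b}" using step.hyps by auto
  have G: "?G (p(b + 1 := z)) = ?G p" for p z
    by (intro prod.cong) auto
  have "[a..b + 1] = [a..b] @ [b + 1]" using step.hyps by (simp add: upto_rec2)
  then have "qmat (prod_list (map f [a..b + 1])) x y =
      (\<Sum>z\<in>UNIV. qmat (prod_list (map f [a..b])) x z * qmat (f (b + 1)) z y)"
    by (simp add: qmat_mult)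
  also have "\<dots> = (\<Sum>z\<in>UNIV. \<Sum>p\<in>{a..b} \<rightarrow>\<^sub>E UNIV. of_bool (p b = z) * ?G p * qmat (f (b + 1)) z y)"
    unfolding step.IH by (simp add: sum_distrib_right)
  also have "\<dots> = (\<Sum>p\<in>{a..b} \<rightarrow>\<^sub>E UNIV. \<Sum>z\<in>UNIV. of_bool (p b = z) * ?G p * qmat (f (b + 1)) z y)"
    by (rule sum.swap)
  also have "\<dots> = (\<Sum>p\<in>{a..b} \<rightarrow>\<^sub>E UNIV. \<Sum>z\<in>UNIV. of_bool (z = y) * (?G p * qmat (f (b + 1)) (p b) z))"
  proof (rule sum.cong[OF refl])
    fix p :: "int \<Rightarrow> bool"
    show "(\<Sum>z\<in>UNIV. of_bool (p b = z) * ?G p * qmat (f (b + 1)) z y) =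
      (\<Sum>z\<in>UNIV. of_bool (z = y) * (?G p * qmat (f (b + 1)) (p b) z))"
      by (simp only: mult.assoc sum_bool_pick)
  qed
  also have "\<dots> = (\<Sum>p\<in>{a..b + 1} \<rightarrow>\<^sub>E UNIV. of_bool (p (b + 1) = y) *
      (\<Prod>k\<in>{a..b + 1}. qmat (f k) (if k = a then x else p (k - 1)) (p k)))"
    unfolding up by (subst sum_PiE_insert) (use step.hyps G in \<open>auto simp: mult_ac\<close>)
  finally show ?case .
qed

lemma qre_prod_list:
  assumes "a \<le> b"
  shows "complex_of_real (qre (prod_list (map f [a..b]))) = (\<Sum>p\<in>{a..b} \<rightarrow>\<^sub>E UNIV.
    \<Prod>k\<in>{a..b}. qmat (f k) (p (if k = a then b else k - 1)) (p k)) / 2"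
proof -
  let ?G = "\<lambda>x p. \<Prod>k\<in>{a..b}. qmat (f k) (if k = a then x else p (k - 1)) (p k)"
  have "(\<Sum>x\<in>UNIV. qmat (prod_list (map f [a..b])) x x) =
      (\<Sum>p\<in>{a..b} \<rightarrow>\<^sub>E UNIV. \<Sum>x\<in>UNIV. of_bool (p b = x) * ?G x p)"
    unfolding qmat_prod_list[OF assms] by (rule sum.swap)
  also have "\<dots> = (\<Sum>p\<in>{a..b} \<rightarrow>\<^sub>E UNIV. ?G (p b) p)"
  proof (intro sum.cong refl)
    fix p :: "int \<Rightarrow> bool"
    show "(\<Sum>x\<in>UNIV. of_bool (p b = x) * ?G x p) = ?G (p b) p"
      by (rule sum_bool_pick)
  qed
  finally show ?thesis
    unfolding qre_eq_half_trace by (simp add: if_distrib[of "_ :: int \<Rightarrow> bool"] cong: if_cong)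
qed

section \<open>The pairing of the black corners\<close>

text \<open>
  The division of \<open>{1..n}\<close> into \<open>m\<close> consecutive blocks, one for each trace.
\<close>
locale block_structure =
  fixes m n :: nat and j :: "nat \<Rightarrow> nat"
  assumes j_pos: "\<And>r. r \<in> {1..m} \<Longrightarrow> j r \<ge> 1"
    and sum_j: "(\<Sum>r=1..m. j r) = n"
begin

abbreviation idx :: "int set" where "idx \<equiv> {1..int n}"

definition block :: "nat \<Rightarrow> int set" where
  "block r = {block_first j r..block_last j r}"

definition block_of :: "int \<Rightarrow> nat" where
  "block_of k = (LEAST r. k \<le> block_last j r)"

text \<open>
  The cyclic predecessor of \<open>k\<close> within its block.
\<close>
definition prev :: "int \<Rightarrow> int" where
  "prev k = (if k = block_first j (block_of k) then block_last j (block_of k) else k - 1)"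

lemma block_last_Suc: "block_last j (Suc r) = block_last j r + int (j (Suc r))"
  by (simp add: block_last_def)

lemma block_first_Suc: "block_first j (Suc r) = block_last j r + 1"
  by (simp add: block_first_def block_last_def atLeastLessThanSuc_atLeastAtMost)

lemma block_last_0: "block_last j 0 = 0" and block_last_m: "block_last j m = int n"
  using sum_j by (simp_all add: block_last_def)

lemma block_last_mono: "r \<le> s \<Longrightarrow> block_last j r \<le> block_last j s"
  by (induction s rule: dec_induct) (simp_all add: block_last_Suc)

lemma block_first_le_last:
  assumes "r \<in> {1..m}" shows "block_first j r \<le> block_last j r"
proof -
  obtain s where "r = Suc s" using assms by (cases r) auto
  then show ?thesis using j_pos[OF assms] by (simp add: block_first_Suc block_last_Suc)
qed

lemma block_of_eq:
  assumes r: "r \<in> {1..m}" and k: "k \<in> block r" shows "block_of k = r"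
  unfolding block_of_def
proof (rule Least_equality)
  show "k \<le> block_last j r" using k by (simp add: block_def)
  fix s assume s: "k \<le> block_last j s"
  show "r \<le> s"
  proof (rule ccontr)
    assume "\<not> r \<le> s"
    then obtain q where q: "r = Suc q" "s \<le> q" by (cases r) auto
    then show False using s k block_last_mono[OF q(2)] by (simp add: block_def block_first_Suc)
  qed
qed

lemma mem_block_of:
  assumes k: "k \<in> idx" shows "block_of k \<in> {1..m}" "k \<in> block (block_of k)"
proof -
  have km: "k \<le> block_last j m" using k by (simp add: block_last_m)
  then have le: "k \<le> block_last j (block_of k)" "block_of k \<le> m"
    unfolding block_of_def by (auto intro: LeastI Least_le)
  moreover have "block_of k \<noteq> 0"
  proof
    assume "block_of k = 0"
    then show False using le(1) k by (simp add: block_last_0)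
  qed
  then obtain q where q: "block_of k = Suc q" by (cases "block_of k") auto
  moreover have "\<not> k \<le> block_last j q"
    using not_less_Least[of q "\<lambda>r. k \<le> block_last j r"] q by (simp add: block_of_def)
  ultimately show "block_of k \<in> {1..m}" "k \<in> block (block_of k)"
    by (auto simp: block_def block_first_Suc)
qed

lemma block_subset:
  assumes r: "r \<in> {1..m}" shows "block r \<subseteq> idx"
proof -
  obtain s where s: "r = Suc s" using r by (cases r) auto
  show ?thesis
    using block_last_mono[of 0 s] block_last_mono[of r m] r s
    by (auto simp: block_def block_last_0 block_last_m block_first_Suc)
qed

lemma Union_blocks: "(\<Union>r\<in>{1..m}. block r) = idx"
  using mem_block_of block_subset by blast

lemma prev_in_block:
  assumes r: "r \<in> {1..m}" and k: "k \<in> block r"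
  shows "prev k = (if k = block_first j r then block_last j r else k - 1)" "prev k \<in> block r"
  using block_of_eq[OF r k] k by (auto simp: prev_def block_def)

lemma bij_prev: "bij_betw prev idx idx"
proof -
  have im: "prev k \<in> idx" "block_of (prev k) = block_of k" if "k \<in> idx" for k
    using mem_block_of[OF that] prev_in_block block_subset block_of_eq by blast+
  have "inj_on prev idx"
  proof (rule inj_onI)
    fix k l assume k: "k \<in> idx" and l: "l \<in> idx" and e: "prev k = prev l"
    then have "block_of k = block_of l" using im by metis
    then show "k = l" using e mem_block_of[OF k] mem_block_of[OF l]
      by (auto simp: prev_def block_def split: if_splits)
  qed
  moreover have "prev ` idx \<subseteq> idx" using im by blast
  ultimately show ?thesis by (simp add: bij_betw_def endo_inj_surj)
qed

text \<open>
  A permutation whose ordered pairs \<open>(rot (-k), rot k) = (prev k, -k)\<close> are the pairs of \<open>\<sigma>\<close>.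
\<close>
definition rot :: "int \<Rightarrow> int" where
  "rot a = (if a \<in> idx then - a else if - a \<in> idx then prev (- a) else a)"

lemma rot_simps: "k \<in> idx \<Longrightarrow> rot k = - k" "k \<in> idx \<Longrightarrow> rot (- k) = prev k"
  by (auto simp: rot_def)

lemma labels_eq_sides: "labels n = sides idx"
proof -
  have "a \<in> uminus ` idx \<longleftrightarrow> - a \<in> idx" for a by (metis image_iff minus_minus)
  then show ?thesis by (auto simp: labels_def sides_def)
qed

lemma idx_pos: "finite idx" "idx \<subseteq> {0<..}" by auto

lemma rot_permutes: "rot permutes sides idx"
proof (rule bij_imp_permutes)
  have "rot ` sides idx = sides idx"
  proof -
    have "rot ` idx = uminus ` idx" using rot_simps by (intro image_cong) auto
    moreover have "rot ` uminus ` idx = prev ` idx"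
      unfolding image_image using rot_simps by (intro image_cong) auto
    moreover have "prev ` idx = idx" using bij_prev by (simp add: bij_betw_def)
    ultimately show ?thesis unfolding sides_def image_Un by auto
  qed
  then show "bij_betw rot (sides idx) (sides idx)"
    using eq_card_imp_inj_on[OF finite_sides[OF idx_pos(1)], of rot] by (simp add: bij_betw_def)
  show "rot a = a" if "a \<notin> sides idx" for a
  proof -
    have "a \<notin> idx" using that by (simp add: sides_def)
    moreover have "- a \<notin> idx"
    proof
      assume "- a \<in> idx"
      then have "- (- a) \<in> uminus ` idx" by (rule imageI)
      then show False using that by (simp add: sides_def)
    qed
    ultimately show ?thesis unfolding rot_def by (simp only: if_False)
  qed
qed

lemma delta_eq_image_pairs: "delta n = image_pairs idx id"
  by (auto simp: delta_def image_pairs_def)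

lemma sigma_eq_image_pairs: "sigma m j = image_pairs idx rot"
proof -
  have "sigma m j = (\<Union>r\<in>{1..m}. (\<lambda>k. {prev k, - k}) ` block r)"
    unfolding sigma_def
  proof (intro SUP_cong refl)
    fix r assume r: "r \<in> {1..m}"
    let ?f = "block_first j r" and ?l = "block_last j r"
    have "block r = insert ?f ((\<lambda>k. k + 1) ` {k. ?f \<le> k \<and> k < ?l})"
    proof (intro equalityI subsetI)
      fix k assume k: "k \<in> block r"
      show "k \<in> insert ?f ((\<lambda>k. k + 1) ` {k. ?f \<le> k \<and> k < ?l})"
      proof (cases "k = ?f")
        case False
        then have "k - 1 \<in> {k. ?f \<le> k \<and> k < ?l}" using k by (auto simp: block_def)
        then have "(k - 1) + 1 \<in> (\<lambda>k. k + 1) ` {k. ?f \<le> k \<and> k < ?l}" by (rule imageI)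
        then show ?thesis by simp
      qed simp
    qed (use block_first_le_last[OF r] in \<open>auto simp: block_def\<close>)
    then have "(\<lambda>k. {prev k, - k}) ` block r = insert {prev ?f, - ?f}
        ((\<lambda>k. {prev (k + 1), - (k + 1)}) ` {k. ?f \<le> k \<and> k < ?l})"
      by (simp only: image_insert image_image)
    also have "(\<lambda>k. {prev (k + 1), - (k + 1)}) ` {k. ?f \<le> k \<and> k < ?l} =
        (\<lambda>k. {k, - (k + 1)}) ` {k. ?f \<le> k \<and> k < ?l}"
    proof (intro image_cong refl)
      fix k assume "k \<in> {k. ?f \<le> k \<and> k < ?l}"
      then have "prev (k + 1) = k" using prev_in_block(1)[OF r, of "k + 1"] by (simp add: block_def)
      then show "{prev (k + 1), - (k + 1)} = {k, - (k + 1)}" by simp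
    qed
    also have "prev ?f = ?l"
      using prev_in_block(1)[OF r, of ?f] block_first_le_last[OF r] by (simp add: block_def)
    finally show "{{k, - (k + 1)} | k. ?f \<le> k \<and> k < ?l} \<union> {{?l, - ?f}} =
        (\<lambda>k. {prev k, - k}) ` block r" by auto
  qed
  also have "\<dots> = (\<lambda>k. {prev k, - k}) ` idx"
    unfolding Union_blocks[symmetric] by (rule image_UN[symmetric])
  also have "\<dots> = image_pairs idx rot"
    unfolding image_pairs_def using rot_simps by (intro image_cong refl) auto
  finally show ?thesis .
qed

text \<open>
  A function that is constant along the edges of \<open>\<delta> \<union> \<sigma>\<close> is a function of the block, so there are
  \<open>2\<^sup>m\<close> of them.
\<close>
lemma card_black_vertices: "card (cycles (delta n) (sigma m j)) = m"
proof -
  let ?S = "sides idx"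
  have perm: "id permutes ?S" "rot permutes ?S" using rot_permutes by (auto simp: permutes_id)
  interpret two_pair_partitions ?S "delta n" "sigma m j"
    unfolding delta_eq_image_pairs sigma_eq_image_pairs
    using finite_sides[OF idx_pos(1)] pair_partition_image_pairs[OF idx_pos(2)] perm
    by unfold_locales auto
  let ?F = "{\<rho> \<in> ?S \<rightarrow>\<^sub>E (UNIV :: bool set). \<forall>a b. {a, b} \<in> delta n \<union> sigma m j \<longrightarrow> \<rho> a = \<rho> b}"
  have inv: "(\<forall>a b. {a, b} \<in> delta n \<union> sigma m j \<longrightarrow> \<rho> a = \<rho> b) \<longleftrightarrow>
      (\<forall>k\<in>idx. \<rho> (- k) = \<rho> k \<and> \<rho> (prev k) = \<rho> k)" for \<rho> :: "int \<Rightarrow> bool"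
  proof -
    have "(\<forall>a b. {a, b} \<in> delta n \<union> sigma m j \<longrightarrow> \<rho> a = \<rho> b) \<longleftrightarrow>
        (\<forall>k\<in>idx. \<rho> (- k) = \<rho> k) \<and> (\<forall>k\<in>idx. \<rho> (rot (- k)) = \<rho> (rot k))"
      unfolding delta_eq_image_pairs sigma_eq_image_pairs image_pairs_def id_apply
      by (auto simp only: Un_iff image_iff doubleton_eq_iff)
    also have "\<dots> \<longleftrightarrow> (\<forall>k\<in>idx. \<rho> (- k) = \<rho> k \<and> \<rho> (prev k) = \<rho> k)"
      using rot_simps by auto
    finally show ?thesis .
  qed
  have sS: "k \<in> ?S" "- k \<in> ?S" if "k \<in> idx" for k using that by (auto simp: sides_def)
  have absS: "\<bar>a\<bar> \<in> idx" if "a \<in> ?S" for a using that by (auto simp: sides_def)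
  let ?\<Phi> = "\<lambda>f. \<lambda>a\<in>?S. f (block_of \<bar>a\<bar>)"
  have "bij_betw ?\<Phi> ({1..m} \<rightarrow>\<^sub>E (UNIV :: bool set)) ?F"
    unfolding bij_betw_def
  proof (intro conjI equalityI subsetI)
    show "inj_on ?\<Phi> ({1..m} \<rightarrow>\<^sub>E UNIV)"
    proof (intro inj_onI PiE_ext[of _ "{1..m}" "\<lambda>_. UNIV"])
      fix f g r assume e: "?\<Phi> f = ?\<Phi> g" and r: "r \<in> {1..m}"
      have b: "block_first j r \<in> block r" using block_first_le_last[OF r] by (simp add: block_def)
      then have i: "block_first j r \<in> idx" using block_subset[OF r] by blast
      then have "\<bar>block_first j r\<bar> = block_first j r" by simp
      then show "f r = g r"
        using fun_cong[OF e, of "block_first j r"] sS[OF i] block_of_eq[OF r b] by simp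
    qed auto
  next
    fix \<rho> assume "\<rho> \<in> ?\<Phi> ` ({1..m} \<rightarrow>\<^sub>E (UNIV :: bool set))"
    then obtain f where f: "\<rho> = ?\<Phi> f" by blast
    have "\<rho> (- k) = \<rho> k \<and> \<rho> (prev k) = \<rho> k" if k: "k \<in> idx" for k
    proof -
      note b = mem_block_of[OF k]
      have p: "prev k \<in> idx" "block_of (prev k) = block_of k"
        using prev_in_block(2)[OF b] block_subset[OF b(1)] block_of_eq[OF b(1)] by blast+
      have "\<bar>k\<bar> = k" "\<bar>prev k\<bar> = prev k" using k p by auto
      then show ?thesis using sS[OF k] sS[OF p(1)] p(2) f by simp
    qed
    then show "\<rho> \<in> ?F" unfolding inv using f by simp
  next
    fix \<rho> assume rho: "\<rho> \<in> ?F"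
    then have st: "\<rho> (- k) = \<rho> k" "\<rho> (prev k) = \<rho> k" if "k \<in> idx" for k
      using inv that by blast+
    have const: "\<rho> k = \<rho> (block_first j r)" if r: "r \<in> {1..m}" and k: "k \<in> block r" for r k
    proof -
      have "block_first j r \<le> k" using k by (simp add: block_def)
      then show ?thesis using k
      proof (induction k rule: int_ge_induct)
        case (step k)
        then have "k \<in> block r" "k + 1 \<noteq> block_first j r" by (auto simp: block_def)
        then show ?case
          using step st(2)[of "k + 1"] prev_in_block(1)[OF r step.prems] block_subset[OF r] by auto
      qed simp
    qed
    let ?f = "\<lambda>r\<in>{1..m}. \<rho> (block_first j r)"
    have "\<rho> = ?\<Phi> ?f"
    proof
      fix a show "\<rho> a = ?\<Phi> ?f a"
      proof (cases "a \<in> ?S")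
        case True
        have "\<rho> a = \<rho> \<bar>a\<bar>" using st(1)[OF absS[OF True]] by (cases "a \<ge> 0") auto
        then show ?thesis using True const mem_block_of[OF absS[OF True]] by simp
      next
        case False
        then show ?thesis using rho by (auto simp: PiE_def extensional_def)
      qed
    qed
    then show "\<rho> \<in> ?\<Phi> ` ({1..m} \<rightarrow>\<^sub>E (UNIV :: bool set))"
      by (rule image_eqI[where x = ?f]) simp
  qed
  then have "card ?F = card ({1..m} \<rightarrow>\<^sub>E (UNIV :: bool set))" by (simp add: bij_betw_same_card)
  then have "(2::nat) ^ card (cycles (delta n) (sigma m j)) = 2 ^ m"
    unfolding card_invariant_functions by (simp add: card_PiE)
  then show ?thesis by simp
qed

text \<open>
  In the contraction of \<open>\<epsilon>\<close> along \<open>\<delta> \<union> \<sigma>\<close> every non-zero term equals \<open>(-1)\<^sup>n\<close>, because going from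
  \<open>prev k\<close> through \<open>-k\<close> to \<open>k\<close> always passes two factors \<open>\<epsilon>\<close> of opposite sign. Comparing with
  \<open>overlap_eps\<close> leaves a non-negative number equal to \<open>sgn rot \<cdot> (-2)\<^sup>m\<close>.
\<close>
lemma sgn_rot: "sgn_pow (-1) rot = (-1) ^ m"
proof -
  have perm: "id permutes sides idx" by (simp add: permutes_id)
  have weight: "(\<Prod>k\<in>idx. eps (\<rho> (- k)) (\<rho> k)) * (\<Prod>k\<in>idx. eps (\<rho> (rot (- k))) (\<rho> (rot k))) =
      (-1) ^ n * of_bool (\<forall>k\<in>idx. \<rho> (- k) \<noteq> \<rho> k \<and> \<rho> (prev k) = \<rho> k)" for \<rho> :: "int \<Rightarrow> bool"
  proof (cases "\<forall>k\<in>idx. \<rho> (- k) \<noteq> \<rho> k \<and> \<rho> (prev k) = \<rho> k")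
    case True
    have "(\<Prod>k\<in>idx. eps (\<rho> (- k)) (\<rho> k)) * (\<Prod>k\<in>idx. eps (\<rho> (rot (- k))) (\<rho> (rot k))) =
        (\<Prod>k\<in>idx. eps (\<rho> (- k)) (\<rho> k) * eps (\<rho> (rot (- k))) (\<rho> (rot k)))"
      by (simp add: prod.distrib)
    also have "\<dots> = (\<Prod>k\<in>idx. -1)"
    proof (intro prod.cong refl)
      fix k assume k: "k \<in> idx"
      then have "\<rho> (- k) \<noteq> \<rho> k" "\<rho> (prev k) = \<rho> k" using True by auto
      then show "eps (\<rho> (- k)) (\<rho> k) * eps (\<rho> (rot (- k))) (\<rho> (rot k)) = -1"
        unfolding rot_simps[OF k] by (cases "\<rho> k") (auto simp: eps_def)
    qed
    finally show ?thesis using True by simp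
  next
    case False
    then obtain k where k: "k \<in> idx" "\<rho> (- k) = \<rho> k \<or> \<rho> (prev k) \<noteq> \<rho> k" by blast
    then have "eps (\<rho> (- k)) (\<rho> k) = 0 \<or> eps (\<rho> (rot (- k))) (\<rho> (rot k)) = 0"
      unfolding rot_simps[OF k(1)] by (auto simp: eps_def)
    then have "(\<Prod>k\<in>idx. eps (\<rho> (- k)) (\<rho> k)) = 0 \<or> (\<Prod>k\<in>idx. eps (\<rho> (rot (- k))) (\<rho> (rot k))) = 0"
      using k(1) by (metis (mono_tags, lifting) idx_pos(1) prod_zero)
    then show ?thesis using False by auto
  qed
  obtain N :: nat where "overlap eps idx id rot = (-1) ^ n * of_nat N"
  proof
    show "overlap eps idx id rot = (-1) ^ n * of_nat (\<Sum>\<rho>\<in>sides idx \<rightarrow>\<^sub>E (UNIV :: bool set).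
        of_bool (\<forall>k\<in>idx. \<rho> (- k) \<noteq> \<rho> k \<and> \<rho> (prev k) = \<rho> k))"
      unfolding overlap_def id_apply weight by (simp only: of_nat_sum of_nat_of_bool sum_distrib_left)
  qed
  moreover have "overlap eps idx id rot = sgn_pow (-1) rot * (-1) ^ n * (-2) ^ m"
    using overlap_eps[OF idx_pos perm rot_permutes] card_black_vertices
    unfolding delta_eq_image_pairs sigma_eq_image_pairs by (simp add: sgn_pow_def)
  ultimately have "sgn_pow (-1) rot * (-2) ^ m = of_nat N"
    by (cases "even n") auto
  then have e: "sgn_pow (-1) rot * (-1) ^ m * of_nat (2 ^ m) = of_nat N"
    by (simp add: power_minus[of 2] mult.assoc)
  have "sgn_pow (-1) rot = 1 \<or> sgn_pow (-1) rot = -1" by (simp add: sgn_pow_def)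
  then consider "sgn_pow (-1) rot = (-1) ^ m" | "sgn_pow (-1) rot * (-1) ^ m = -1"
    by (cases "even m") auto
  then show ?thesis
  proof cases
    case 2
    then have "of_nat N = - (2 ^ m :: complex)" using e by simp
    then have "of_nat (N + 2 ^ m) = (0 :: complex)" by simp
    then show ?thesis unfolding of_nat_eq_0_iff by simp
  qed
qed

section \<open>The contribution of one pairing\<close>

lemma prod_sum_blocks:
  fixes H :: "nat \<Rightarrow> (int \<Rightarrow> bool) \<Rightarrow> 'c :: comm_semiring_1"
  shows "(\<Prod>r=1..m. \<Sum>p\<in>block r \<rightarrow>\<^sub>E UNIV. H r p) =
    (\<Sum>p\<in>idx \<rightarrow>\<^sub>E UNIV. \<Prod>r=1..m. H r (restrict p (block r)))"
proof -
  have fb: "finite (block r \<rightarrow>\<^sub>E (UNIV :: bool set))" for r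
    by (intro finite_PiE) (auto simp: block_def)
  have "(\<Prod>r=1..m. \<Sum>p\<in>block r \<rightarrow>\<^sub>E UNIV. H r p) =
      (\<Sum>P\<in>PiE {1..m} (\<lambda>r. block r \<rightarrow>\<^sub>E UNIV). \<Prod>r=1..m. H r (P r))"
    using fb by (intro prod_sum_PiE) auto
  also have "\<dots> = (\<Sum>p\<in>idx \<rightarrow>\<^sub>E UNIV. \<Prod>r=1..m. H r (restrict p (block r)))"
  proof (rule sum.reindex_bij_witness[where i = "\<lambda>p. \<lambda>r\<in>{1..m}. restrict p (block r)" and
        j = "\<lambda>P. \<lambda>k\<in>idx. P (block_of k) k"])
    fix P assume P: "P \<in> PiE {1..m} (\<lambda>r. block r \<rightarrow>\<^sub>E (UNIV :: bool set))"
    have eq: "restrict (\<lambda>k\<in>idx. P (block_of k) k) (block r) = P r" if r: "r \<in> {1..m}" for r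
    proof
      fix k show "restrict (\<lambda>k\<in>idx. P (block_of k) k) (block r) k = P r k"
        using block_subset[OF r] block_of_eq[OF r, of k] PiE_mem[OF P r]
        by (cases "k \<in> block r") (auto simp: PiE_def extensional_def)
    qed
    show "(\<lambda>r\<in>{1..m}. restrict (\<lambda>k\<in>idx. P (block_of k) k) (block r)) = P"
      using P eq by (auto simp: fun_eq_iff PiE_def extensional_def)
    show "(\<Prod>r=1..m. H r (restrict (\<lambda>k\<in>idx. P (block_of k) k) (block r))) = (\<Prod>r=1..m. H r (P r))"
      using eq by (intro prod.cong) auto
  next
    fix p :: "int \<Rightarrow> bool" assume p: "p \<in> idx \<rightarrow>\<^sub>E UNIV"
    show "(\<lambda>k\<in>idx. (\<lambda>r\<in>{1..m}. restrict p (block r)) (block_of k) k) = p"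
    proof
      fix k show "(\<lambda>k\<in>idx. (\<lambda>r\<in>{1..m}. restrict p (block r)) (block_of k) k) k = p k"
      proof (cases "k \<in> idx")
        case True
        then show ?thesis using mem_block_of[OF True] by simp
      next
        case False
        then show ?thesis using p by (auto simp: PiE_def extensional_def)
      qed
    qed
  qed auto
  finally show ?thesis .
qed

lemma prod_blocks: "(\<Prod>r=1..m. \<Prod>k\<in>block r. f k) = (\<Prod>k\<in>idx. f k)"
  unfolding Union_blocks[symmetric]
proof (rule prod.UNION_disjoint[symmetric])
  show "\<forall>r\<in>{1..m}. \<forall>s\<in>{1..m}. r \<noteq> s \<longrightarrow> block r \<inter> block s = {}"
    using block_of_eq by blast
qed (auto simp: block_def)

text \<open>
  The contractions that come from the traces and the conjugations: columns along \<open>\<sigma>\<close>, rows along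
  \<open>\<delta>\<close>. The rows are taken in the order \<open>(k, -k)\<close>, opposite to that of \<open>overlap\<close>.
\<close>
definition index_weight :: "(int \<Rightarrow> bool) \<Rightarrow> (int \<Rightarrow> bool) \<Rightarrow> complex" where
  "index_weight \<kappa> \<rho> = (\<Prod>k\<in>idx. eps (\<kappa> (prev k)) (\<kappa> (- k)) * eps (\<rho> k) (\<rho> (- k)))"

text \<open>
  The trace of a block is a sum over closed index paths, and each conjugated factor is replaced by
  \<open>qmat_qcnj\<close>. The column index of the label \<open>k\<close> is the path index \<open>p k\<close>; the row index of \<open>k\<close> and
  both indices of \<open>-k\<close> are those summed over in the \<open>k\<close>-th factor.
\<close>
lemma trace_product_expansion:
  fixes x :: "int \<Rightarrow> quat"
  shows "complex_of_real (\<Prod>r=1..m. qre (prod_list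
      (map (\<lambda>k. qcnj (x (- k)) * x k) [block_first j r..block_last j r]))) =
    (\<Sum>\<kappa>\<in>sides idx \<rightarrow>\<^sub>E UNIV. \<Sum>\<rho>\<in>sides idx \<rightarrow>\<^sub>E UNIV.
      index_weight \<kappa> \<rho> * (\<Prod>a\<in>sides idx. qmat (x a) (\<rho> a) (\<kappa> a))) / 2 ^ m"
proof -
  let ?f = "\<lambda>k. qcnj (x (- k)) * x k"
  let ?J = "\<lambda>k u v u' q' q. eps u u' * eps q q' * (qmat (x (- k)) q' u' * qmat (x k) q v)"
  have f: "qmat (?f k) u v = (\<Sum>u'\<in>UNIV. \<Sum>q'\<in>UNIV. \<Sum>q\<in>UNIV. ?J k u v u' q' q)" for k u v
    unfolding qmat_mult qmat_qcnj by (simp add: sum_bool algebra_simps)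
  have "complex_of_real (\<Prod>r=1..m. qre (prod_list (map ?f [block_first j r..block_last j r]))) =
      (\<Prod>r=1..m. (\<Sum>p\<in>block r \<rightarrow>\<^sub>E UNIV. \<Prod>k\<in>block r.
        qmat (?f k) (p (if k = block_first j r then block_last j r else k - 1)) (p k)) / 2)"
    unfolding of_real_prod block_def
    by (intro prod.cong refl qre_prod_list block_first_le_last)
  also have "\<dots> = (\<Prod>r=1..m. (\<Sum>p\<in>block r \<rightarrow>\<^sub>E UNIV. \<Prod>k\<in>block r. qmat (?f k) (p (prev k)) (p k))) / 2 ^ m"
  proof -
    have "(\<Prod>k\<in>block r. qmat (?f k) (p (if k = block_first j r then block_last j r else k - 1)) (p k)) =
        (\<Prod>k\<in>block r. qmat (?f k) (p (prev k)) (p k))" if "r \<in> {1..m}" for r p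
      using prev_in_block(1)[OF that] by (intro prod.cong) auto
    then show ?thesis by (simp add: prod_dividef)
  qed
  also have "(\<Prod>r=1..m. (\<Sum>p\<in>block r \<rightarrow>\<^sub>E UNIV. \<Prod>k\<in>block r. qmat (?f k) (p (prev k)) (p k))) =
      (\<Sum>p\<in>idx \<rightarrow>\<^sub>E UNIV. \<Prod>k\<in>idx. qmat (?f k) (p (prev k)) (p k))"
    unfolding prod_sum_blocks prod_blocks[symmetric]
    using prev_in_block(2) by (intro sum.cong prod.cong refl) auto
  also have "\<dots> = (\<Sum>p\<in>idx \<rightarrow>\<^sub>E UNIV. \<Sum>u\<in>idx \<rightarrow>\<^sub>E UNIV. \<Prod>k\<in>idx.
      \<Sum>q'\<in>UNIV. \<Sum>q\<in>UNIV. ?J k (p (prev k)) (p k) (u k) q' q)"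
    unfolding f by (intro sum.cong refl prod_sum_PiE) auto
  also have "\<dots> = (\<Sum>\<kappa>\<in>sides idx \<rightarrow>\<^sub>E UNIV. \<Prod>k\<in>idx.
      \<Sum>q'\<in>UNIV. \<Sum>q\<in>UNIV. ?J k (\<kappa> (prev k)) (\<kappa> k) (\<kappa> (- k)) q' q)"
    unfolding sum_PiE_sides[OF idx_pos(2), symmetric]
  proof (intro sum.cong refl prod.cong)
    fix p u :: "int \<Rightarrow> bool" and k q q' assume k: "k \<in> idx"
    then have "prev k \<in> idx" using bij_prev bij_betwE by blast
    then show "?J k (p (prev k)) (p k) (u k) q' q =
      ?J k ((\<lambda>a\<in>sides idx. if a \<in> idx then p a else u (- a)) (prev k))
        ((\<lambda>a\<in>sides idx. if a \<in> idx then p a else u (- a)) k)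
        ((\<lambda>a\<in>sides idx. if a \<in> idx then p a else u (- a)) (- k)) q' q"
      using k by (auto simp: sides_def)
  qed
  also have "\<dots> = (\<Sum>\<kappa>\<in>sides idx \<rightarrow>\<^sub>E UNIV. \<Sum>\<rho>\<in>sides idx \<rightarrow>\<^sub>E UNIV. \<Prod>k\<in>idx.
      ?J k (\<kappa> (prev k)) (\<kappa> k) (\<kappa> (- k)) (\<rho> (- k)) (\<rho> k))"
    by (intro sum.cong refl prod_sum_sides idx_pos) auto
  also have "\<dots> = (\<Sum>\<kappa>\<in>sides idx \<rightarrow>\<^sub>E UNIV. \<Sum>\<rho>\<in>sides idx \<rightarrow>\<^sub>E UNIV.
      index_weight \<kappa> \<rho> * (\<Prod>a\<in>sides idx. qmat (x a) (\<rho> a) (\<kappa> a)))"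
    unfolding index_weight_def prod_sides[OF idx_pos] by (simp only: prod.distrib)
  finally show ?thesis .
qed

text \<open>
  If the units at the two ends of each pair agree, the sum over all units is a product of
  covariances over the pairs.
\<close>
lemma sum_unit_mat_pairing:
  assumes g: "g permutes sides idx"
  shows "(\<Sum>c\<in>sides idx \<rightarrow>\<^sub>E coords. (\<Prod>a\<in>sides idx. unit_mat (c a) (\<rho> a) (\<kappa> a)) *
      of_bool (\<forall>k\<in>idx. c (g (- k)) = c (g k))) =
    (\<Prod>k\<in>idx. 2 * (eps (\<rho> (g (- k))) (\<rho> (g k)) * eps (\<kappa> (g (- k))) (\<kappa> (g k))))"
proof -
  let ?f = "\<lambda>k x y. unit_mat x (\<rho> (g (- k))) (\<kappa> (g (- k))) * unit_mat y (\<rho> (g k)) (\<kappa> (g k)) *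
    of_bool (x = y)"
  let ?r = "\<lambda>c. restrict (c \<circ> g) (sides idx)"
  have s: "k \<in> sides idx" "- k \<in> sides idx" if "k \<in> idx" for k using that by (auto simp: sides_def)
  have ob: "of_bool (\<forall>k\<in>idx. P k) = (\<Prod>k\<in>idx. of_bool (P k) :: complex)" for P
  proof -
    have "of_bool (\<forall>k\<in>I. P k) = (\<Prod>k\<in>I. of_bool (P k) :: complex)" if "finite I" for I :: "int set"
      using that by (induction I rule: finite_induct) auto
    then show ?thesis by simp
  qed
  have "(\<Prod>a\<in>sides idx. unit_mat (c a) (\<rho> a) (\<kappa> a)) * of_bool (\<forall>k\<in>idx. c (g (- k)) = c (g k)) =
      (\<Prod>k\<in>idx. ?f k (?r c (- k)) (?r c k))" for c
  proof -
    have perm: "(\<Prod>a\<in>sides idx. unit_mat (c a) (\<rho> a) (\<kappa> a)) =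
        (\<Prod>a\<in>sides idx. unit_mat (c (g a)) (\<rho> (g a)) (\<kappa> (g a)))"
      using prod.permute[OF g, of "\<lambda>a. unit_mat (c a) (\<rho> a) (\<kappa> a)"] by (simp add: o_def)
    show ?thesis
      unfolding perm prod_sides[OF idx_pos] ob prod.distrib[symmetric]
      by (intro prod.cong refl) (simp add: s)
  qed
  then have "(\<Sum>c\<in>sides idx \<rightarrow>\<^sub>E coords. (\<Prod>a\<in>sides idx. unit_mat (c a) (\<rho> a) (\<kappa> a)) *
      of_bool (\<forall>k\<in>idx. c (g (- k)) = c (g k))) =
      (\<Sum>c\<in>sides idx \<rightarrow>\<^sub>E coords. \<Prod>k\<in>idx. ?f k (?r c (- k)) (?r c k))" by simp
  also have "\<dots> = (\<Sum>c\<in>sides idx \<rightarrow>\<^sub>E coords. \<Prod>k\<in>idx. ?f k (c (- k)) (c k))"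
    by (rule sum_PiE_permute[OF g])
  also have "\<dots> = (\<Prod>k\<in>idx. \<Sum>x\<in>coords. \<Sum>y\<in>coords. ?f k x y)"
    by (rule prod_sum_sides[OF idx_pos finite_coords, symmetric])
  also have "\<dots> = (\<Prod>k\<in>idx. 2 * (eps (\<rho> (g (- k))) (\<rho> (g k)) * eps (\<kappa> (g (- k))) (\<kappa> (g k))))"
  proof (intro prod.cong refl)
    fix k
    have "(\<Sum>x\<in>coords. \<Sum>y\<in>coords. ?f k x y) =
        (\<Sum>x\<in>coords. unit_mat x (\<rho> (g (- k))) (\<kappa> (g (- k))) * unit_mat x (\<rho> (g k)) (\<kappa> (g k)))"
      using finite_coords by (intro sum.cong refl) (simp add: of_bool_def if_distrib sum.delta cong: if_cong)
    then show "(\<Sum>x\<in>coords. \<Sum>y\<in>coords. ?f k x y) =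
        2 * (eps (\<rho> (g (- k))) (\<rho> (g k)) * eps (\<kappa> (g (- k))) (\<kappa> (g k)))"
      by (simp add: unit_mat_covariance)
  qed
  finally show ?thesis .
qed

text \<open>
  Rows and columns separate. The sign in \<open>(-2) ^ n\<close> comes from reversing the order of the pairs of
  \<open>\<delta>\<close> in \<open>index_weight\<close>.
\<close>
lemma index_sum_eq_overlaps:
  "(\<Sum>\<kappa>\<in>sides idx \<rightarrow>\<^sub>E UNIV. \<Sum>\<rho>\<in>sides idx \<rightarrow>\<^sub>E UNIV. index_weight \<kappa> \<rho> *
      (\<Prod>k\<in>idx. 2 * (eps (\<rho> (g (- k))) (\<rho> (g k)) * eps (\<kappa> (g (- k))) (\<kappa> (g k))))) =
    (-2) ^ n * (overlap eps idx id g * overlap eps idx rot g)"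
proof -
  let ?R = "\<lambda>\<rho>. (\<Prod>k\<in>idx. eps (\<rho> (- k)) (\<rho> k)) * (\<Prod>k\<in>idx. eps (\<rho> (g (- k))) (\<rho> (g k)))"
  let ?K = "\<lambda>\<kappa>. (\<Prod>k\<in>idx. eps (\<kappa> (rot (- k))) (\<kappa> (rot k))) * (\<Prod>k\<in>idx. eps (\<kappa> (g (- k))) (\<kappa> (g k)))"
  have "index_weight \<kappa> \<rho> * (\<Prod>k\<in>idx. 2 * (eps (\<rho> (g (- k))) (\<rho> (g k)) * eps (\<kappa> (g (- k))) (\<kappa> (g k)))) =
      (-2) ^ n * (?K \<kappa> * ?R \<rho>)" for \<kappa> \<rho>
  proof -
    have "(\<Prod>k\<in>idx. eps (\<rho> k) (\<rho> (- k))) = (\<Prod>k\<in>idx. (-1) * eps (\<rho> (- k)) (\<rho> k))"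
      by (intro prod.cong refl unit_formD(2)[OF unit_form_eps])
    then have "(\<Prod>k\<in>idx. eps (\<rho> k) (\<rho> (- k))) = (-1) ^ n * (\<Prod>k\<in>idx. eps (\<rho> (- k)) (\<rho> k))"
      unfolding prod.distrib by simp
    moreover have "(\<Prod>k\<in>idx. eps (\<kappa> (prev k)) (\<kappa> (- k))) = (\<Prod>k\<in>idx. eps (\<kappa> (rot (- k))) (\<kappa> (rot k)))"
      using rot_simps by (intro prod.cong refl) simp
    moreover have "(-2 :: complex) ^ n = (-1) ^ n * 2 ^ n" by (rule power_minus)
    ultimately show ?thesis
      unfolding index_weight_def prod.distrib by (simp add: mult_ac)
  qed
  then have "(\<Sum>\<kappa>\<in>sides idx \<rightarrow>\<^sub>E UNIV. \<Sum>\<rho>\<in>sides idx \<rightarrow>\<^sub>E UNIV. index_weight \<kappa> \<rho> *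
      (\<Prod>k\<in>idx. 2 * (eps (\<rho> (g (- k))) (\<rho> (g k)) * eps (\<kappa> (g (- k))) (\<kappa> (g k))))) =
      (\<Sum>\<kappa>\<in>sides idx \<rightarrow>\<^sub>E UNIV. \<Sum>\<rho>\<in>sides idx \<rightarrow>\<^sub>E UNIV. (-2) ^ n * (?K \<kappa> * ?R \<rho>))" by simp
  also have "\<dots> = (-2) ^ n * ((\<Sum>\<kappa>\<in>sides idx \<rightarrow>\<^sub>E UNIV. ?K \<kappa>) * (\<Sum>\<rho>\<in>sides idx \<rightarrow>\<^sub>E UNIV. ?R \<rho>))"
    by (simp only: sum_product) (simp only: sum_distrib_left)
  finally show ?thesis unfolding overlap_def id_apply by (simp add: mult_ac)
qed

lemma two_pair_partitions_delta_sigma: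
  assumes "pair_partition (labels n) \<gamma>"
  shows "two_pair_partitions (labels n) (delta n) (sigma m j)"
    "two_pair_partitions (labels n) (delta n) \<gamma>"
proof -
  note d = pair_partition_image_pairs[OF idx_pos(2) permutes_id]
    and s = pair_partition_image_pairs[OF idx_pos(2) rot_permutes]
  show "two_pair_partitions (labels n) (delta n) (sigma m j)"
    unfolding labels_eq_sides delta_eq_image_pairs sigma_eq_image_pairs
    by (rule two_pair_partitions.intro[OF finite_sides[OF idx_pos(1)] d s])
  show "two_pair_partitions (labels n) (delta n) \<gamma>"
    using assms unfolding labels_eq_sides delta_eq_image_pairs
    by (rule two_pair_partitions.intro[OF finite_sides[OF idx_pos(1)] d])
qed

lemma euler_char_eq:
  assumes g: "pair_partition (labels n) \<gamma>"
  shows "euler_char (moebius_graph_of n m j \<gamma>) =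
    int m + int (card (cycles (delta n) \<gamma>)) - int n + int (card (cycles (sigma m j) \<gamma>))"
proof -
  interpret ds: two_pair_partitions "labels n" "delta n" "sigma m j"
    using two_pair_partitions_delta_sigma[OF g] by simp
  interpret dg: two_pair_partitions "labels n" "delta n" \<gamma>
    using two_pair_partitions_delta_sigma[OF g] by simp
  let ?R = "ribbons (moebius_graph_of n m j \<gamma>)"
  have R: "?R = {(k, b, w). k \<in> idx \<and> b \<in> cycles (delta n) (sigma m j) \<and> {k, - k} \<in> fst b \<and>
      w \<in> cycles (delta n) \<gamma> \<and> {k, - k} \<in> fst w}"
    by (simp add: moebius_graph_of_def)
  have ex1: "\<exists>!b. b \<in> cycles (delta n) (sigma m j) \<and> {k, - k} \<in> fst b"
    "\<exists>!w. w \<in> cycles (delta n) \<gamma> \<and> {k, - k} \<in> fst w" if "k \<in> idx" for k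
  proof -
    have d: "{k, - k} \<in> delta n" unfolding delta_def using that by blast
    show "\<exists>!b. b \<in> cycles (delta n) (sigma m j) \<and> {k, - k} \<in> fst b" using ds.ex1_cycle_of_pair[OF d] .
    show "\<exists>!w. w \<in> cycles (delta n) \<gamma> \<and> {k, - k} \<in> fst w" using dg.ex1_cycle_of_pair[OF d] .
  qed
  have "inj_on fst ?R"
  proof (rule inj_onI)
    fix x y assume xy: "x \<in> ?R" "y \<in> ?R" "fst x = fst y"
    obtain k b w b' w' where x: "x = (k, b, w)" and y: "y = (k, b', w')"
      using xy(3) by (metis prod.collapse)
    have k: "k \<in> idx" using xy(1) unfolding R x by blast
    have "b = b'" using ex1(1)[OF k] xy(1,2) unfolding R x y by (metis (mono_tags, lifting) case_prodD mem_Collect_eq)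
    moreover have "w = w'" using ex1(2)[OF k] xy(1,2) unfolding R x y by (metis (mono_tags, lifting) case_prodD mem_Collect_eq)
    ultimately show "x = y" by (simp add: x y)
  qed
  moreover have "fst ` ?R = idx"
  proof (intro equalityI subsetI)
    fix k assume k: "k \<in> idx"
    then obtain b w where "b \<in> cycles (delta n) (sigma m j) \<and> {k, - k} \<in> fst b"
      "w \<in> cycles (delta n) \<gamma> \<and> {k, - k} \<in> fst w" using ex1 by blast
    then have "(k, b, w) \<in> ?R" using k unfolding R by blast
    then have "fst (k, b, w) \<in> fst ` ?R" by (rule imageI)
    then show "k \<in> fst ` ?R" by simp
  next
    fix k assume "k \<in> fst ` ?R"
    then obtain b w where "(k, b, w) \<in> ?R" by force
    then show "k \<in> idx" unfolding R by blast
  qed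
  ultimately have "card ?R = n" using card_image[of fst ?R] by simp
  moreover have "faces (moebius_graph_of n m j \<gamma>) = cycles (sigma m j) \<gamma>"
    unfolding faces_def by (simp add: moebius_graph_of_def ds.Union_snd_cycles dg.Union_snd_cycles)
  ultimately show ?thesis
    by (simp add: euler_char_def card_black_vertices) (simp add: moebius_graph_of_def card_black_vertices)
qed

text \<open>
  The corners of the white vertices are the pairs of \<open>\<gamma>\<close>, so distinct pairings give distinct graphs
  and a sum over graphs is a sum over pairings.
\<close>
lemma inj_moebius_graph_of:
  "inj_on (moebius_graph_of n m j) {\<gamma>. pair_partition (labels n) \<gamma>}"
proof (rule inj_onI)
  fix \<gamma> \<gamma>' assume g: "\<gamma> \<in> {\<gamma>. pair_partition (labels n) \<gamma>}" "\<gamma>' \<in> {\<gamma>. pair_partition (labels n) \<gamma>}"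
    and e: "moebius_graph_of n m j \<gamma> = moebius_graph_of n m j \<gamma>'"
  have U: "\<Union>(snd ` cycles (delta n) \<gamma>) = \<gamma>" if "pair_partition (labels n) \<gamma>" for \<gamma>
    using two_pair_partitions.Union_snd_cycles[OF two_pair_partitions_delta_sigma(2)[OF that]] .
  have "cycles (delta n) \<gamma> = cycles (delta n) \<gamma>'" using e by (simp add: moebius_graph_of_def)
  then show "\<gamma> = \<gamma>'" using U g by (metis mem_Collect_eq)
qed

lemma m_le_n: "m \<le> n"
proof -
  have "(\<Sum>r=1..m. 1) \<le> (\<Sum>r=1..m. j r)" using j_pos by (intro sum_mono) auto
  then show ?thesis using sum_j by simp
qed

text \<open>
  The row sum is \<open>sgn \<gamma> (-1)\<^sup>n (-2)\<^sup>w\<close> and the column sum \<open>(-1)\<^sup>m sgn \<gamma> (-1)\<^sup>n (-2)\<^sup>f\<close>, with \<open>w\<close> white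
  vertices and \<open>f\<close> faces. The sign of \<open>\<gamma>\<close>, which depends on the chosen order of its pairs, cancels.
\<close>
lemma pairing_contribution:
  assumes g: "pair_partition (labels n) \<gamma>"
  shows "(\<Sum>\<kappa>\<in>sides idx \<rightarrow>\<^sub>E UNIV. \<Sum>\<rho>\<in>sides idx \<rightarrow>\<^sub>E UNIV. index_weight \<kappa> \<rho> *
      (\<Sum>c\<in>sides idx \<rightarrow>\<^sub>E coords. (\<Prod>a\<in>sides idx. unit_mat (c a) (\<rho> a) (\<kappa> a)) *
        of_bool (\<forall>a b. {a, b} \<in> \<gamma> \<longrightarrow> c a = c b))) / 2 ^ m =
    of_real (4 ^ (n - m) * (-2) powi euler_char (moebius_graph_of n m j \<gamma>))"
proof -
  obtain p where p: "p permutes sides idx" and gp: "\<gamma> = image_pairs idx p"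
    using pair_partition_obtain_permutation[OF idx_pos] g unfolding labels_eq_sides by metis
  let ?w = "card (cycles (delta n) \<gamma>)" and ?f = "card (cycles (sigma m j) \<gamma>)"
  have inv: "(\<forall>a b. {a, b} \<in> \<gamma> \<longrightarrow> c a = c b) \<longleftrightarrow> (\<forall>k\<in>idx. c (p (- k)) = c (p k))"
    for c :: "int \<Rightarrow> quat \<Rightarrow> real"
    unfolding gp image_pairs_def by (auto simp only: image_iff doubleton_eq_iff)
  have s: "sgn_pow (-1) p * sgn_pow (-1) p = 1" by (simp add: sgn_pow_def)
  have "overlap eps idx id p * overlap eps idx rot p =
      (sgn_pow (-1) p * sgn_pow (-1) p) * ((-1) ^ n * (-1) ^ n) * (-1) ^ m * (-2) ^ (?w + ?f)"
    unfolding overlap_eps[OF idx_pos permutes_id p] overlap_eps[OF idx_pos rot_permutes p] sgn_rot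
      gp delta_eq_image_pairs sigma_eq_image_pairs
    by (simp add: sgn_pow_def power_add)
  also have "\<dots> = (-1) ^ m * (-2) ^ (?w + ?f)"
    unfolding s power_mult_distrib[symmetric] by simp
  finally have ov: "overlap eps idx id p * overlap eps idx rot p = (-1) ^ m * (-2) ^ (?w + ?f)" .
  obtain d where d: "n = m + d" using m_le_n le_Suc_ex by blast
  have "(\<Sum>\<kappa>\<in>sides idx \<rightarrow>\<^sub>E UNIV. \<Sum>\<rho>\<in>sides idx \<rightarrow>\<^sub>E UNIV. index_weight \<kappa> \<rho> *
      (\<Sum>c\<in>sides idx \<rightarrow>\<^sub>E coords. (\<Prod>a\<in>sides idx. unit_mat (c a) (\<rho> a) (\<kappa> a)) *
        of_bool (\<forall>a b. {a, b} \<in> \<gamma> \<longrightarrow> c a = c b))) / 2 ^ m =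
      (-2) ^ n * ((-1) ^ m * (-2) ^ (?w + ?f)) / 2 ^ m"
    unfolding inv sum_unit_mat_pairing[OF p] index_sum_eq_overlaps ov ..
  also have "\<dots> = (-2) ^ d * (-2) ^ (?w + ?f) * (((-2) ^ m * (-1) ^ m) / 2 ^ m)"
    by (simp add: d power_add)
  also have "((-2 :: complex) ^ m * (-1) ^ m) / 2 ^ m = 1"
    unfolding power_mult_distrib[symmetric] by simp
  also have "(-2) ^ d * (-2) ^ (?w + ?f) * 1 = complex_of_real ((-2) ^ d * (-2) ^ (?w + ?f))" by simp
  also have "(-2 :: real) ^ d * (-2) ^ (?w + ?f) = 4 ^ d * (-2) powi (int (?w + ?f) - int d)"
  proof -
    have "(4 :: real) ^ d = (-2) ^ d * (-2) ^ d"
      unfolding power_mult_distrib[symmetric] by simp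
    then show ?thesis by (simp add: power_int_diff del: of_nat_add)
  qed
  also have "int (?w + ?f) - int d = euler_char (moebius_graph_of n m j \<gamma>)"
    using euler_char_eq[OF g] d by simp
  finally show ?thesis by (simp add: d)
qed

end

section \<open>The expectation of a product of real parts\<close>

lemma card_pairings_prod:
  assumes "finite A"
  shows "card (pairings (\<lambda>a. (t a, c a)) A) =
    (\<Sum>\<gamma>\<in>pairings t A. of_bool (\<forall>a b. {a, b} \<in> \<gamma> \<longrightarrow> c a = c b))"
proof -
  have "pairings (\<lambda>a. (t a, c a)) A = pairings t A \<inter> {\<gamma>. \<forall>a b. {a, b} \<in> \<gamma> \<longrightarrow> c a = c b}"
    unfolding pairings_def by blast
  then show ?thesis
    using finite_pairings[OF assms, of t] by (simp only: sum_of_bool_eq of_nat_id)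
qed

theorem theorem3p2:
  fixes M :: "'a measure" and Z :: "nat \<Rightarrow> 'a \<Rightarrow> quat"
    and n m :: nat and j :: "nat \<Rightarrow> nat" and t :: "int \<Rightarrow> nat" and X :: "int \<Rightarrow> 'a \<Rightarrow> quat"
  assumes "prob_space M"
    and "prob_space.indep_vars M (\<lambda>_. borel) Z {1..n}"
    and "\<And>l. l \<in> {1..n} \<Longrightarrow> prob_space.std_quat_gaussian M (Z l)"
    and "\<And>a. a \<in> labels n \<Longrightarrow> t a \<in> {1..n}"
    and "\<And>a. a \<in> labels n \<Longrightarrow> X a = Z (t a)"
    and "m \<ge> 1"
    and "\<And>r. r \<in> {1..m} \<Longrightarrow> j r \<ge> 1"
    and "(\<Sum>r=1..m. j r) = n"
  defines "W \<equiv> (\<lambda>\<omega>. \<Prod>r=1..m.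
      qre (prod_list (map (\<lambda>k. qcnj (X (- k) \<omega>) * X k \<omega>) [block_first j r..block_last j r])))"
  shows "integrable M W \<and>
    prob_space.expectation M W =
      4 ^ (n - m) * (\<Sum>\<Gamma> \<in> moebius_graphs n m j t. (-2) powi (euler_char \<Gamma>))"
proof -
  interpret prob_space M by fact
  interpret block_structure m n j using assms by unfold_locales auto
  let ?S = "sides idx"
  let ?I = "?S \<rightarrow>\<^sub>E (UNIV :: bool set)" and ?C = "?S \<rightarrow>\<^sub>E coords"
  have fS: "finite ?S" using finite_sides[OF idx_pos(1)] .
  have fin: "finite ?I" "finite ?C" using fS finite_coords by (auto intro: finite_PiE)
  let ?U = "\<lambda>\<kappa> \<rho> c. \<Prod>a\<in>?S. unit_mat (c a) (\<rho> a) (\<kappa> a)"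
  let ?N = "\<lambda>c. of_nat (card (pairings (\<lambda>a. (t a, c a)) ?S)) :: complex"
  let ?V = "\<lambda>\<gamma>. (-2 :: real) powi euler_char (moebius_graph_of n m j \<gamma>)"
  have W: "complex_of_real (W \<omega>) = (\<Sum>\<kappa>\<in>?I. \<Sum>\<rho>\<in>?I. index_weight \<kappa> \<rho> *
      (\<Sum>c\<in>?C. ?U \<kappa> \<rho> c * complex_of_real (\<Prod>a\<in>?S. c a (Z (t a) \<omega>)))) / 2 ^ m" for \<omega>
  proof -
    have "(\<Prod>a\<in>?S. qmat (X a \<omega>) (\<rho> a) (\<kappa> a)) =
        (\<Sum>c\<in>?C. ?U \<kappa> \<rho> c * complex_of_real (\<Prod>a\<in>?S. c a (Z (t a) \<omega>)))" for \<kappa> \<rho>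
    proof -
      have "(\<Prod>a\<in>?S. qmat (X a \<omega>) (\<rho> a) (\<kappa> a)) =
          (\<Prod>a\<in>?S. \<Sum>d\<in>coords. unit_mat d (\<rho> a) (\<kappa> a) * of_real (d (Z (t a) \<omega>)))"
        proof (intro prod.cong refl)
        fix a assume "a \<in> ?S"
        then have "X a = Z (t a)" using assms(5) labels_eq_sides by simp
        then show "qmat (X a \<omega>) (\<rho> a) (\<kappa> a) =
            (\<Sum>d\<in>coords. unit_mat d (\<rho> a) (\<kappa> a) * of_real (d (Z (t a) \<omega>)))"
          by (simp only: qmat_coords)
      qed
      also have "\<dots> = (\<Sum>c\<in>?C. \<Prod>a\<in>?S. unit_mat (c a) (\<rho> a) (\<kappa> a) * of_real (c a (Z (t a) \<omega>)))"
        using fS finite_coords by (intro prod_sum_PiE) auto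
      finally show ?thesis by (simp add: prod.distrib)
    qed
    then show ?thesis unfolding W_def trace_product_expansion[of "\<lambda>a. X a \<omega>"] by simp
  qed
  \<comment> \<open>Expectations of the monomials in the real coordinates.\<close>
  have mono: "has_bochner_integral M (\<lambda>\<omega>. complex_of_real (\<Prod>a\<in>?S. c a (Z (t a) \<omega>))) (?N c)"
    if c: "c \<in> ?C" for c
  proof -
    have "t ` ?S \<subseteq> {1..n}" "c ` ?S \<subseteq> coords" using assms(4) labels_eq_sides c by auto
    note gw = gaussian_wick[OF assms(2,3) finite_atLeastAtMost fS this]
    have "has_bochner_integral M (\<lambda>\<omega>. \<Prod>a\<in>?S. c a (Z (t a) \<omega>))
        (of_nat (card (pairings (\<lambda>a. (t a, c a)) ?S)))"
      using gw by (simp add: has_bochner_integral_iff)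
    from has_bochner_integral_of_real[OF this, where 'a = complex] show ?thesis by simp
  qed
  have "has_bochner_integral M (\<lambda>\<omega>. complex_of_real (W \<omega>))
      ((\<Sum>\<kappa>\<in>?I. \<Sum>\<rho>\<in>?I. index_weight \<kappa> \<rho> * (\<Sum>c\<in>?C. ?U \<kappa> \<rho> c * ?N c)) / 2 ^ m)"
    unfolding W
    by (intro has_bochner_integral_divide_zero has_bochner_integral_sum
        has_bochner_integral_mult_right mono)
  \<comment> \<open>A pairing compatible with \<open>t\<close> and \<open>c\<close> is one compatible with \<open>t\<close> on which \<open>c\<close> is constant.\<close>
  also have "(\<Sum>\<kappa>\<in>?I. \<Sum>\<rho>\<in>?I. index_weight \<kappa> \<rho> * (\<Sum>c\<in>?C. ?U \<kappa> \<rho> c * ?N c)) / 2 ^ m =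
      (\<Sum>\<gamma>\<in>pairings t ?S. (\<Sum>\<kappa>\<in>?I. \<Sum>\<rho>\<in>?I. index_weight \<kappa> \<rho> *
        (\<Sum>c\<in>?C. ?U \<kappa> \<rho> c * of_bool (\<forall>a b. {a, b} \<in> \<gamma> \<longrightarrow> c a = c b))) / 2 ^ m)"
  proof -
    let ?b = "\<lambda>c \<gamma>. of_bool (\<forall>a b. {a, b} \<in> \<gamma> \<longrightarrow> c a = c b) :: complex"
    have N: "?N c = (\<Sum>\<gamma>\<in>pairings t ?S. ?b c \<gamma>)" for c :: "int \<Rightarrow> quat \<Rightarrow> real"
      unfolding card_pairings_prod[OF fS] by (simp only: of_nat_sum of_nat_of_bool)
    have "(\<Sum>c\<in>?C. ?U \<kappa> \<rho> c * ?N c) = (\<Sum>\<gamma>\<in>pairings t ?S. \<Sum>c\<in>?C. ?U \<kappa> \<rho> c * ?b c \<gamma>)" for \<kappa> \<rho>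
      unfolding N sum_distrib_left by (rule sum.swap)
    then have "(\<Sum>\<kappa>\<in>?I. \<Sum>\<rho>\<in>?I. index_weight \<kappa> \<rho> * (\<Sum>c\<in>?C. ?U \<kappa> \<rho> c * ?N c)) =
        (\<Sum>\<kappa>\<in>?I. \<Sum>\<rho>\<in>?I. \<Sum>\<gamma>\<in>pairings t ?S. index_weight \<kappa> \<rho> * (\<Sum>c\<in>?C. ?U \<kappa> \<rho> c * ?b c \<gamma>))"
      by (simp only: sum_distrib_left)
    also have "\<dots> = (\<Sum>\<kappa>\<in>?I. \<Sum>\<gamma>\<in>pairings t ?S. \<Sum>\<rho>\<in>?I. index_weight \<kappa> \<rho> * (\<Sum>c\<in>?C. ?U \<kappa> \<rho> c * ?b c \<gamma>))"
      by (intro sum.cong[OF refl] sum.swap)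
    also have "\<dots> = (\<Sum>\<gamma>\<in>pairings t ?S. \<Sum>\<kappa>\<in>?I. \<Sum>\<rho>\<in>?I. index_weight \<kappa> \<rho> * (\<Sum>c\<in>?C. ?U \<kappa> \<rho> c * ?b c \<gamma>))"
      by (rule sum.swap)
    finally show ?thesis by (simp only: sum_divide_distrib)
  qed
  also have "\<dots> = (\<Sum>\<gamma>\<in>pairings t ?S. of_real (4 ^ (n - m) * ?V \<gamma>))"
    by (intro sum.cong refl pairing_contribution) (simp add: pairings_def labels_eq_sides)
  also have "\<dots> = of_real (4 ^ (n - m) * (\<Sum>\<gamma>\<in>pairings t ?S. ?V \<gamma>))"
    by (simp only: of_real_sum sum_distrib_left)
  also have "(\<Sum>\<gamma>\<in>pairings t ?S. ?V \<gamma>) = (\<Sum>\<Gamma>\<in>moebius_graphs n m j t. (-2) powi (euler_char \<Gamma>))"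
  proof -
    have "inj_on (moebius_graph_of n m j) (pairings t ?S)"
      by (rule inj_on_subset[OF inj_moebius_graph_of]) (auto simp: pairings_def labels_eq_sides)
    moreover have "moebius_graphs n m j t = moebius_graph_of n m j ` pairings t ?S"
      by (simp add: moebius_graphs_def pairings_def labels_eq_sides)
    ultimately show ?thesis by (simp add: sum.reindex)
  qed
  finally have "has_bochner_integral M (\<lambda>\<omega>. complex_of_real (W \<omega>))
    (of_real (4 ^ (n - m) * (\<Sum>\<Gamma>\<in>moebius_graphs n m j t. (-2) powi (euler_char \<Gamma>))))" .
  then show ?thesis
    by (simp only: has_bochner_integral_iff complex_of_real_integrable_eq integral_complex_of_real of_real_eq_iff)
qed

end
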